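(* Let $E$ and $F$ be real Banach lattices and let $T:E\to F$ be an order bounded operator. Suppose that one of the following holds: (i) $E$ has sequentially weakly continuous lattice operations; (ii) $F'$ has sequentially weakly continuous lattice operations; (iii) $T$ is positive and $F$ is discrete with order continuous norm. Then $T$ is an almost weak Dunford-Pettis operator if and only if $T$ is a weak Dunford-Pettis operator.
   Context: An operator means a bounded linear map. An operator $T:E\to F$ between Banach lattices is order bounded if it maps order bounded sets to order bounded sets, and positive if $T(E^+)\subset F^+$. $T$ is weak Dunford-Pettis (wDP) if $f_n(Tx_n)\to 0$ whenever $(x_n)$ is weakly null in $E$ and $(f_n)$ is weakly null in $F'$. $T$ is almost weak Dunford-Pettis (awDP) if $f_n(Tx_n)\to 0$ whenever $(x_n)\subset E$ is a disjoint weakly null sequence and $(f_n)\subset F'$ is a disjoint weakly null sequence (disjoint meaning $|x_n|\wedge|x_m|=0$ for $n\neq m$). A Banach lattice has sequentially weakly continuous lattice operations if $|x_n|\to 0$ weakly for every weakly null sequence $(x_n)$. A Banach lattice is discrete (atomic) if every nontrivial interval $[0,x]$ contains a discrete element, where $x>0$ is discrete if $u,v\in[0,x]$, $u\wedge v=0$ imply $u=0$ or $v=0$. The norm is order continuous if $x_\alpha\downarrow 0$ implies $\|x_\alpha\|\to 0$. *)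

theory Defs
  imports "HOL-Analysis.Analysis"
begin

definition labs :: "'a::{lattice, uminus} \<Rightarrow> 'a" where
  "labs x = sup x (- x)"

class banach_lattice = banach + lattice + ordered_real_vector +
  assumes lattice_norm: "sup x (- x) \<le> sup y (- y) \<Longrightarrow> norm x \<le> norm y"

definition weakly_null :: "(nat \<Rightarrow> 'v::real_normed_vector) \<Rightarrow> bool" where
  "weakly_null x \<longleftrightarrow> (\<forall>\<phi> :: 'v \<Rightarrow>\<^sub>L real. (\<lambda>n. blinfun_apply \<phi> (x n)) \<longlonglongrightarrow> 0)"

definition dual_le :: "('b::banach_lattice \<Rightarrow>\<^sub>L real) \<Rightarrow> ('b \<Rightarrow>\<^sub>L real) \<Rightarrow> bool" where
  "dual_le f g \<longleftrightarrow> (\<forall>x::'b. 0 \<le> x \<longrightarrow> blinfun_apply f x \<le> blinfun_apply g x)"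

definition dual_abs :: "('b::banach_lattice \<Rightarrow>\<^sub>L real) \<Rightarrow> ('b \<Rightarrow>\<^sub>L real) \<Rightarrow> bool" where
  "dual_abs h f \<longleftrightarrow> dual_le f h \<and> dual_le (- f) h \<and>
     (\<forall>k. dual_le f k \<and> dual_le (- f) k \<longrightarrow> dual_le h k)"

definition dual_disjoint :: "('b::banach_lattice \<Rightarrow>\<^sub>L real) \<Rightarrow> ('b \<Rightarrow>\<^sub>L real) \<Rightarrow> bool" where
  "dual_disjoint f g \<longleftrightarrow> (\<exists>a b. dual_abs a f \<and> dual_abs b g \<and>
     dual_le 0 a \<and> dual_le 0 b \<and>
     (\<forall>k. dual_le k a \<and> dual_le k b \<longrightarrow> dual_le k 0))"

definition disjoint_seq :: "(nat \<Rightarrow> 'a::banach_lattice) \<Rightarrow> bool" where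
  "disjoint_seq x \<longleftrightarrow> (\<forall>n m. n \<noteq> m \<longrightarrow> inf (labs (x n)) (labs (x m)) = 0)"

definition dual_disjoint_seq :: "(nat \<Rightarrow> ('b::banach_lattice \<Rightarrow>\<^sub>L real)) \<Rightarrow> bool" where
  "dual_disjoint_seq f \<longleftrightarrow> (\<forall>n m. n \<noteq> m \<longrightarrow> dual_disjoint (f n) (f m))"

definition order_bounded_op :: "('a::banach_lattice \<Rightarrow> 'b::banach_lattice) \<Rightarrow> bool" where
  "order_bounded_op T \<longleftrightarrow>
     (\<forall>A. (\<exists>a b. A \<subseteq> {a..b}) \<longrightarrow> (\<exists>c d. T ` A \<subseteq> {c..d}))"

definition positive_op :: "('a::banach_lattice \<Rightarrow> 'b::banach_lattice) \<Rightarrow> bool" where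
  "positive_op T \<longleftrightarrow> (\<forall>x. 0 \<le> x \<longrightarrow> 0 \<le> T x)"

definition wDP :: "('a::banach_lattice \<Rightarrow> 'b::banach_lattice) \<Rightarrow> bool" where
  "wDP T \<longleftrightarrow> (\<forall>(x :: nat \<Rightarrow> 'a) (f :: nat \<Rightarrow> ('b \<Rightarrow>\<^sub>L real)).
      weakly_null x \<and> weakly_null f \<longrightarrow> (\<lambda>n. blinfun_apply (f n) (T (x n))) \<longlonglongrightarrow> 0)"

definition awDP :: "('a::banach_lattice \<Rightarrow> 'b::banach_lattice) \<Rightarrow> bool" where
  "awDP T \<longleftrightarrow> (\<forall>(x :: nat \<Rightarrow> 'a) (f :: nat \<Rightarrow> ('b \<Rightarrow>\<^sub>L real)).
      disjoint_seq x \<and> weakly_null x \<and> dual_disjoint_seq f \<and> weakly_null f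
        \<longrightarrow> (\<lambda>n. blinfun_apply (f n) (T (x n))) \<longlonglongrightarrow> 0)"

definition swclo :: "'a::banach_lattice itself \<Rightarrow> bool" where
  "swclo _ \<longleftrightarrow> (\<forall>x :: nat \<Rightarrow> 'a. weakly_null x \<longrightarrow> weakly_null (\<lambda>n. labs (x n)))"

definition dual_swclo :: "'b::banach_lattice itself \<Rightarrow> bool" where
  "dual_swclo _ \<longleftrightarrow> (\<forall>(f :: nat \<Rightarrow> ('b \<Rightarrow>\<^sub>L real)) h.
      weakly_null f \<and> (\<forall>n. dual_abs (h n) (f n)) \<longrightarrow> weakly_null h)"

definition discrete_elem :: "'a::banach_lattice \<Rightarrow> bool" where
  "discrete_elem x \<longleftrightarrow> 0 < x \<and>
     (\<forall>u v. u \<in> {0..x} \<and> v \<in> {0..x} \<and> inf u v = 0 \<longrightarrow> u = 0 \<or> v = 0)"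

definition discrete_lattice :: "'a::banach_lattice itself \<Rightarrow> bool" where
  "discrete_lattice _ \<longleftrightarrow> (\<forall>x::'a. 0 < x \<longrightarrow> (\<exists>d \<in> {0..x}. discrete_elem d))"

text \<open>Order continuous norm: x_\<alpha> \<down> 0 implies norm x_\<alpha> \<rightarrow> 0.  A decreasing net
is represented by its (downward directed) range D, indexed by itself with the
reversed order; "\<down> 0" means D has greatest lower bound 0.\<close>

definition order_continuous_norm :: "'a::banach_lattice itself \<Rightarrow> bool" where
  "order_continuous_norm _ \<longleftrightarrow> (\<forall>D :: 'a set.
     D \<noteq> {} \<and> (\<forall>a\<in>D. \<forall>b\<in>D. \<exists>c\<in>D. c \<le> a \<and> c \<le> b) \<and>
     (\<forall>d\<in>D. 0 \<le> d) \<and> (\<forall>z. (\<forall>d\<in>D. z \<le> d) \<longrightarrow> z \<le> 0)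
     \<longrightarrow> (\<forall>e>0. \<exists>d\<in>D. \<forall>d'\<in>D. d' \<le> d \<longrightarrow> norm d' < e))"

end

theory Submission
  imports Defs "HOL-Library.Lattice_Algebras"
begin

text \<open>Let \<open>x\<^sub>n\<close> and \<open>f\<^sub>n\<close> be weakly null. The key fact is that a disjoint sequence with
  \<open>0 \<le> u\<^sub>n \<le> x\<^sub>n\<^sup>+\<close> is again weakly null: the components of a positive functional on the bands
  generated by the \<open>u\<^sub>n\<close> sum up to a functional, so a Schur-type gliding hump applies to their
  values at the \<open>x\<^sub>n\<close>. If \<open>f\<^sub>n (T x\<^sub>n)\<close> is uniformly small for \<open>f\<^sub>n\<close> replaced by elements of an order
  interval, then along a subsequence \<open>f\<^sub>n\<^sup>+\<close> may be replaced by disjoint \<open>u\<^sub>n\<close> below it without changing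
  the limit of \<open>f\<^sub>n (T x\<^sub>n)\<close>; the \<open>u\<^sub>n\<close> are positive and weakly null, so by order boundedness of \<open>T\<close>
  the same replacement is possible on the side of \<open>x\<^sub>n\<close>, and the almost weak Dunford-Pettis property
  finishes the argument. The required uniform smallness holds on one of the two sides in each case:
  in (i) and (ii) because positive and negative parts of weakly null sequences are weakly null, in
  (iii) because a discrete Banach lattice with order continuous norm has sequentially weakly
  continuous lattice operations.\<close>

text \<open>An order bounded operator into a lattice that is not Dedekind complete need not have a
  modulus, so no step may use one. All estimates concern the bilinear form \<open>f (T x)\<close> on
  order intervals of either argument. For positive weakly null functionals, smallness on intervals
  holds because \<open>T\<close> maps an interval into an interval. For positive weakly null points
  it holds because \<open>h (labs (T x))\<close> is dominated on the positive cone by a bounded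
  functional. A signed weakly null sequence admits neither estimate in general, since its modulus
  may fail to be weakly null; the three alternatives serve to secure the first estimate, and after
  one replacement the second comes from positivity. The order dual is turned into a Banach lattice
  type so that points and functionals fall under the same lemmas. Norm boundedness of weakly null
  sequences is proved because it yields a single \<open>w\<close> with \<open>pprt (x n)\<close>
  below \<open>2^n\<close> times \<open>w\<close>; the powers of 2 and 4 below stem from
  this.\<close>

instance banach_lattice \<subseteq> lattice_ab_group_add ..

section \<open>Vector lattice calculus\<close>

lemma pprt_diff_pprt_uminus: "pprt x - pprt (- x) = (x::'a::lattice_ab_group_add)"
  using prts[of x] by (simp add: pprt_neg)

lemma pprt_add_pprt_uminus: "pprt x + pprt (- x) = labs (x::'a::banach_lattice)"
proof -
  have "pprt x + pprt (- x) = sup x 0 + (sup x 0 - x)"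
    using pprt_diff_pprt_uminus[of x] unfolding pprt_def by (metis add_diff_cancel_left' diff_add_cancel)
  also have "sup x 0 - x = sup 0 (- x)"
    using add_sup_distrib_right[of x 0 "- x"] by simp
  also have "sup x 0 + sup 0 (- x) = sup (sup x (x + - x)) (sup 0 (- x))"
    by (simp only: add_sup_distrib_left add_sup_distrib_right add_0 add_0_right) (simp add: ac_simps)
  also have "\<dots> = sup 0 (labs x)"
    by (simp add: labs_def ac_simps)
  also have "\<dots> = labs x"
  proof -
    have "x \<le> labs x" "- x \<le> labs x" by (simp_all add: labs_def)
    then have "0 \<le> labs x + labs x" using add_mono by fastforce
    then show ?thesis by (simp add: sup_absorb2)
  qed
  finally show ?thesis .
qed

lemma inf_pprt_pprt_uminus: "inf (pprt x) (pprt (- x)) = (0::'a::lattice_ab_group_add)"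
proof -
  have "inf (pprt x) (pprt (- x)) = inf (pprt (-x) + x) (pprt (-x) + 0)"
    using pprt_diff_pprt_uminus[of x] by (simp add: algebra_simps)
  also have "\<dots> = - nprt x + nprt x"
    by (simp only: add_inf_distrib_left pprt_neg nprt_def)
  also have "\<dots> = 0"
    by (rule left_minus)
  finally show ?thesis .
qed

lemma le_pprt: "x \<le> pprt (x::'a::lattice_ab_group_add)"
  by (simp add: pprt_def)

lemma labs_ge: "x \<le> labs x" "- x \<le> labs (x::'a::banach_lattice)"
  by (simp_all add: labs_def)

lemma labs_nonneg: "0 \<le> labs (x::'a::banach_lattice)"
  by (simp flip: pprt_add_pprt_uminus)

lemma labs_of_nonneg: "0 \<le> x \<Longrightarrow> labs (x::'a::banach_lattice) = x"
  by (simp flip: pprt_add_pprt_uminus)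

lemma norm_mono_nonneg:
  fixes x y :: "'a::banach_lattice"
  assumes "0 \<le> x" "x \<le> y"
  shows "norm x \<le> norm y"
proof (rule lattice_norm)
  show "sup x (- x) \<le> sup y (- y)"
    using labs_of_nonneg[of x] labs_of_nonneg[of y] assms by (auto simp: labs_def)
qed

lemma norm_labs: "norm (labs x) = norm (x::'a::banach_lattice)"
proof -
  have "sup (labs x) (- labs x) = sup x (- x)"
    using labs_of_nonneg[OF labs_nonneg[of x]] by (simp add: labs_def)
  then show ?thesis
    by (metis lattice_norm order.eq_iff)
qed

lemma norm_pprt_le: "norm (pprt x) \<le> norm (x::'a::banach_lattice)"
proof -
  have "pprt x \<le> labs x"
    by (simp flip: pprt_add_pprt_uminus)
  then show ?thesis
    using norm_mono_nonneg[of "pprt x" "labs x"] by (simp add: norm_labs)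
qed

lemma diff_inf_eq_pprt: "z - inf z x = pprt (z - (x::'a::lattice_ab_group_add))"
  by (simp add: diff_inf_eq_sup pprt_def sup_commute add_sup_distrib_left)

lemma riesz_decomposition:
  fixes x y z :: "'a::lattice_ab_group_add"
  assumes "0 \<le> x" "0 \<le> y" "0 \<le> z" "z \<le> x + y"
  obtains a b where "z = a + b" "0 \<le> a" "a \<le> x" "0 \<le> b" "b \<le> y"
proof
  show "z = inf z x + pprt (z - x)"
    using diff_inf_eq_pprt[of z x] by (metis add.commute diff_add_cancel)
  show "pprt (z - x) \<le> y"
    using assms by (simp add: pprt_def algebra_simps)
qed (use assms in auto)

lemma inf_add_le:
  fixes x y z :: "'a::lattice_ab_group_add"
  assumes "0 \<le> x" "0 \<le> y" "0 \<le> z"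
  shows "inf z (x + y) \<le> inf z x + inf z y"
proof -
  have "inf z (x + y) \<le> x + y" "0 \<le> inf z (x+y)" using assms by auto
  then obtain a b where ab: "inf z (x + y) = a + b" "0 \<le> a" "a \<le> x" "0 \<le> b" "b \<le> y"
    using riesz_decomposition assms by metis
  have "a + b \<le> z"
    using ab(1) by (metis inf_le1)
  then have "a \<le> z" "b \<le> z"
    using ab(2,4) by (auto intro: order_trans[of _ "a + b"])
  then have "a \<le> inf z x" "b \<le> inf z y"
    using ab by auto
  then show ?thesis
    unfolding ab(1) by (rule add_mono)
qed

lemma scaleR_inf_distrib:
  fixes x y :: "'a::banach_lattice"
  assumes "0 < c"
  shows "c *\<^sub>R inf x y = inf (c *\<^sub>R x) (c *\<^sub>R y)"
proof (rule order.antisym)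
  show "c *\<^sub>R inf x y \<le> inf (c *\<^sub>R x) (c *\<^sub>R y)"
    using assms by (auto intro!: scaleR_left_mono)
  have "inverse c *\<^sub>R inf (c *\<^sub>R x) (c *\<^sub>R y) \<le> inf x y"
  proof (rule le_infI)
    have "inverse c *\<^sub>R inf (c *\<^sub>R x) (c *\<^sub>R y) \<le> inverse c *\<^sub>R (c *\<^sub>R x)"
      using assms by (intro scaleR_left_mono) auto
    then show "inverse c *\<^sub>R inf (c *\<^sub>R x) (c *\<^sub>R y) \<le> x" using assms by simp
    have "inverse c *\<^sub>R inf (c *\<^sub>R x) (c *\<^sub>R y) \<le> inverse c *\<^sub>R (c *\<^sub>R y)"
      using assms by (intro scaleR_left_mono) auto
    then show "inverse c *\<^sub>R inf (c *\<^sub>R x) (c *\<^sub>R y) \<le> y" using assms by simp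
  qed
  then have "c *\<^sub>R (inverse c *\<^sub>R inf (c *\<^sub>R x) (c *\<^sub>R y)) \<le> c *\<^sub>R inf x y"
    using assms by (intro scaleR_left_mono) auto
  then show "inf (c *\<^sub>R x) (c *\<^sub>R y) \<le> c *\<^sub>R inf x y" using assms by simp
qed

lemma disjoint_mono:
  fixes a b x y :: "'a::lattice_ab_group_add"
  assumes "inf x y = 0" "0 \<le> a" "a \<le> x" "0 \<le> b" "b \<le> y"
  shows "inf a b = 0"
proof (rule order.antisym)
  show "inf a b \<le> 0" using inf_mono[OF assms(3,5)] assms(1) by simp
qed (use assms in simp)

lemma disjoint_scaleR:
  fixes x y :: "'a::banach_lattice"
  assumes "inf x y = 0" "0 \<le> x" "0 \<le> y" "0 \<le> c"
  shows "inf x (c *\<^sub>R y) = 0"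
proof (rule disjoint_mono)
  \<comment> \<open>The factor \<open>c + 1\<close> is positive and dominates both 1 and
    \<open>c\<close>, so scaling both elements by it covers small \<open>c\<close> and
    \<open>c = 0\<close> as well.\<close>
  show "inf ((c+1) *\<^sub>R x) ((c+1) *\<^sub>R y) = 0"
    using scaleR_inf_distrib[of "c+1" x y] assms by simp
  show "x \<le> (c+1) *\<^sub>R x"
    using scaleR_nonneg_nonneg[of c x] assms by (simp add: scaleR_left_distrib)
  show "c *\<^sub>R y \<le> (c+1) *\<^sub>R y"
    using assms by (intro scaleR_right_mono) auto
  show "0 \<le> c *\<^sub>R y"
    using assms by (intro scaleR_nonneg_nonneg)
qed (use assms in auto)

section \<open>Closedness of the positive cone and its consequences\<close>

text \<open>The negative part of the limit lies below \<open>pprt (X n - x)\<close> because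
  \<open>X n\<close> is positive, so its norm is at most the distance from \<open>X n\<close> to
  \<open>x\<close>.\<close>

lemma tendsto_nonneg_cone:
  fixes x :: "'a::banach_lattice"
  assumes "(\<lambda>n. X n) \<longlonglongrightarrow> x" "\<And>n. 0 \<le> X n"
  shows "0 \<le> x"
proof -
  have "norm (pprt (- x)) \<le> norm (X n - x)" for n
  proof -
    have "pprt (- x) \<le> pprt (X n - x)"
      using assms(2)[of n] by (intro pprt_mono) simp
    then have "norm (pprt (- x)) \<le> norm (pprt (X n - x))"
      by (intro norm_mono_nonneg) auto
    then show ?thesis using norm_pprt_le order_trans by blast
  qed
  moreover have "(\<lambda>n. norm (X n - x)) \<longlonglongrightarrow> 0"
    using assms(1) by (simp add: LIM_zero tendsto_norm_zero)
  ultimately have "norm (pprt (- x)) \<le> 0"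
    by (intro tendsto_lowerbound[of _ 0 sequentially]) auto
  then show ?thesis
    using le_zero_iff_zero_pprt[of "- x"] by simp
qed

text \<open>A form of the archimedean property; it is a consequence of the closed positive
  cone.\<close>

lemma le_of_le_scaleR_add:
  fixes x y z :: "'a::banach_lattice"
  assumes "\<And>e. e > 0 \<Longrightarrow> x \<le> y + e *\<^sub>R z"
  shows "x \<le> y"
proof -
  have "(\<lambda>n. y + inverse (real (Suc n)) *\<^sub>R z - x) \<longlonglongrightarrow> y + 0 *\<^sub>R z - x"
    by (intro tendsto_intros LIMSEQ_inverse_real_of_nat)
  then have "0 \<le> y + 0 *\<^sub>R z - x"
    by (rule tendsto_nonneg_cone) (use assms in simp)
  then show ?thesis by simp
qed

text \<open>Substitute for an order bound of a norm bounded sequence: \<open>w\<close> is the series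
  of the terms weighted by \<open>(1/2)^n\<close>. It drives both the automatic continuity below and
  the disjointification.\<close>

lemma weighted_suminf:
  fixes x :: "nat \<Rightarrow> 'a::banach_lattice"
  assumes "\<And>n. 0 \<le> x n" "\<And>n. norm (x n) \<le> C"
  obtains w where "0 \<le> w" "\<And>n. x n \<le> (2^n) *\<^sub>R w"
proof -
  let ?f = "\<lambda>n. ((1/2)^n) *\<^sub>R x n"
  have s: "summable ?f"
  proof (rule summable_comparison_test)
    show "\<exists>N. \<forall>n\<ge>N. norm (?f n) \<le> C * (1/2)^n"
      using mult_left_mono[OF assms(2), of "(1/2)^n" for n] by (simp add: mult.commute)
    show "summable (\<lambda>n. C * (1/2::real)^n)"
      by (intro summable_mult summable_geometric) auto
  qed
  have nn: "0 \<le> ?f n" for n using assms(1) by (intro scaleR_nonneg_nonneg) auto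
  have *: "?f n \<le> suminf ?f" for n
  proof -
    \<comment> \<open>The shift by \<open>Suc n\<close> puts the index \<open>n\<close> into every
      partial sum, so that its term can be split off.\<close>
    have "(\<lambda>m. (\<Sum>i<m + Suc n. ?f i) - ?f n) \<longlonglongrightarrow> suminf ?f - ?f n"
      by (rule tendsto_diff[OF LIMSEQ_ignore_initial_segment[OF summable_LIMSEQ[OF s]] tendsto_const])
    moreover have "0 \<le> (\<Sum>i<m + Suc n. ?f i) - ?f n" for m
    proof -
      have "(\<Sum>i<m + Suc n. ?f i) = ?f n + (\<Sum>i\<in>{..<m + Suc n} - {n}. ?f i)"
        by (rule sum.remove) auto
      moreover have "0 \<le> (\<Sum>i\<in>{..<m + Suc n} - {n}. ?f i)"
        by (rule sum_nonneg) (rule nn)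
      ultimately show ?thesis by simp
    qed
    ultimately have "0 \<le> suminf ?f - ?f n"
      by (rule tendsto_nonneg_cone)
    then show ?thesis by simp
  qed
  show thesis
  proof
    show "0 \<le> suminf ?f" using *[of 0] nn[of 0] by simp
    fix n
    have "(2^n) *\<^sub>R ?f n \<le> (2^n) *\<^sub>R suminf ?f"
      by (rule scaleR_left_mono[OF *]) simp
    then show "x n \<le> (2^n) *\<^sub>R suminf ?f" by (simp add: power_divide)
  qed
qed

section \<open>Positive functionals\<close>

lemma blinfun_pos_mono:
  fixes \<phi> :: "'a::banach_lattice \<Rightarrow>\<^sub>L real"
  assumes "\<And>x. 0 \<le> x \<Longrightarrow> 0 \<le> \<phi> x" "x \<le> y"
  shows "\<phi> x \<le> \<phi> y"
  using assms(1)[of "y - x"] assms(2) by (simp add: blinfun.bilinear_simps)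

text \<open>Monotonicity replaces continuity: with \<open>k\<close> the integer part of
  \<open>n * t\<close>, the vector \<open>n t x\<close> lies between \<open>k x\<close> and
  \<open>(k + 1) x\<close>. The error in homogeneity, multiplied by any \<open>n\<close>, thus stays
  below \<open>q x\<close>.\<close>

lemma additive_imp_homogeneous:
  fixes q :: "'a::banach_lattice \<Rightarrow> real"
  assumes add: "\<And>x y. 0 \<le> x \<Longrightarrow> 0 \<le> y \<Longrightarrow> q (x + y) = q x + q y"
    and nn: "\<And>x. 0 \<le> x \<Longrightarrow> 0 \<le> q x"
    and t: "0 \<le> t" and x: "0 \<le> x"
  shows "q (t *\<^sub>R x) = t * q x"
proof -
  have mono: "q a \<le> q b" if "0 \<le> a" "a \<le> b" for a b
    using add[of a "b - a"] nn[of "b - a"] that by simp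
  have nat: "q (real n *\<^sub>R y) = real n * q y" if "0 \<le> y" for n y
  proof (induction n)
    case 0
    show ?case using add[of 0 0] by simp
  next
    case (Suc n)
    have "q (real n *\<^sub>R y + y) = q (real n *\<^sub>R y) + q y"
      using that by (intro add) (auto intro: scaleR_nonneg_nonneg)
    with Suc show ?case by (simp add: algebra_simps)
  qed
  have bound: "real n * \<bar>q (t *\<^sub>R x) - t * q x\<bar> \<le> q x" for n
  proof -
    define k where "k = nat \<lfloor>real n * t\<rfloor>"
    have k: "real k \<le> real n * t" "real n * t \<le> real (Suc k)"
      using t unfolding k_def by (simp_all add: of_nat_nat le_floor_iff) linarith
    have "q (real k *\<^sub>R x) \<le> q (real n *\<^sub>R (t *\<^sub>R x))"
      "q (real n *\<^sub>R (t *\<^sub>R x)) \<le> q (real (Suc k) *\<^sub>R x)"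
      using k x t by (auto intro!: mono scaleR_nonneg_nonneg simp del: of_nat_Suc intro: scaleR_right_mono)
    then have "real k * q x \<le> real n * q (t *\<^sub>R x)" "real n * q (t *\<^sub>R x) \<le> real (Suc k) * q x"
      using nat[OF x] nat[OF scaleR_nonneg_nonneg[OF t x]] by metis+
    moreover have "real k * q x \<le> real n * t * q x" "real n * t * q x \<le> real (Suc k) * q x"
      using k nn[OF x] by (auto intro!: mult_right_mono simp del: of_nat_Suc)
    ultimately have "\<bar>real n * q (t *\<^sub>R x) - real n * t * q x\<bar> \<le> q x"
      by (auto simp: algebra_simps abs_le_iff)
    moreover have "\<bar>real n * q (t *\<^sub>R x) - real n * t * q x\<bar> = real n * \<bar>q (t *\<^sub>R x) - t * q x\<bar>"
      using abs_mult[of "real n" "q (t *\<^sub>R x) - t * q x"] by (simp add: algebra_simps)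
    ultimately show ?thesis by simp
  qed
  have "q (t *\<^sub>R x) - t * q x = 0"
  proof (rule ccontr)
    assume "\<not> ?thesis"
    then have "0 < \<bar>q (t *\<^sub>R x) - t * q x\<bar>" by simp
    then obtain n where "q x < real n * \<bar>q (t *\<^sub>R x) - t * q x\<bar>"
      using reals_Archimedean3 by blast
    with bound[of n] show False by simp
  qed
  then show ?thesis by simp
qed

text \<open>Automatic continuity of positive maps. Otherwise there are positive \<open>x n\<close>
  in the unit ball with \<open>q (x n) > 4^n\<close>; all of them lie below multiples
  \<open>2^n\<close> of one \<open>w\<close>, which forces \<open>q w > 2^n\<close> for every
  \<open>n\<close>.\<close>

lemma additive_imp_bounded:
  fixes q :: "'a::banach_lattice \<Rightarrow> real"
  assumes add: "\<And>x y. 0 \<le> x \<Longrightarrow> 0 \<le> y \<Longrightarrow> q (x + y) = q x + q y"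
    and nn: "\<And>x. 0 \<le> x \<Longrightarrow> 0 \<le> q x"
  shows "\<exists>C. \<forall>x. 0 \<le> x \<longrightarrow> q x \<le> C * norm x"
proof (rule ccontr)
  assume neg: "\<not> ?thesis"
  have hom: "q (t *\<^sub>R x) = t * q x" if "0 \<le> t" "0 \<le> x" for t x
    using additive_imp_homogeneous[of q t x] add nn that by blast
  have mono: "q a \<le> q b" if "0 \<le> a" "a \<le> b" for a b
    using add[of a "b - a"] nn[of "b - a"] that by simp
  have "\<exists>x. 0 \<le> x \<and> norm x \<le> 1 \<and> 4^n < q x" for n :: nat
  proof -
    obtain x where x: "0 \<le> x" "4^n * norm x < q x"
      using neg by (metis not_less)
    have "norm x \<noteq> 0"
      using x hom[of 0 0] by auto
    moreover have "4^n < q (inverse (norm x) *\<^sub>R x)"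
    proof -
      have "4^n < inverse (norm x) * q x"
        using x(2) \<open>norm x \<noteq> 0\<close> by (simp add: field_simps)
      then show ?thesis using x(1) hom[of "inverse (norm x)" x] by simp
    qed
    ultimately show ?thesis
      using x by (intro exI[of _ "inverse (norm x) *\<^sub>R x"]) (auto intro!: scaleR_nonneg_nonneg)
  qed
  then obtain x where x: "\<And>n. 0 \<le> x n" "\<And>n. norm (x n) \<le> 1" "\<And>n. 4^n < q (x n)"
    by metis
  obtain w where w: "0 \<le> w" "\<And>n. x n \<le> (2^n) *\<^sub>R w"
    using weighted_suminf[of x 1] x by metis
  have "2^n < q w" for n :: nat
  proof -
    have "4^n < q ((2^n) *\<^sub>R w)"
      using x(3)[of n] mono[OF x(1) w(2)[of n]] by simp
    also have "\<dots> = 2^n * q w"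
      using w by (intro hom) auto
    finally have "2^n * 2^n < 2^n * q w"
      by (simp flip: power_mult_distrib)
    then show ?thesis by simp
  qed
  moreover obtain n where "q w < 2^n"
    using real_arch_pow[of 2 "q w"] by auto
  ultimately show False by (meson less_asym)
qed

text \<open>Kantorovich extension together with automatic continuity. Every functional below that is
  given by a formula on the positive cone (majorants, band components, sums of components,
  coordinates) is produced by it.\<close>

lemma additive_extend:
  fixes q :: "'a::banach_lattice \<Rightarrow> real"
  assumes add: "\<And>x y. 0 \<le> x \<Longrightarrow> 0 \<le> y \<Longrightarrow> q (x + y) = q x + q y"
    and nn: "\<And>x. 0 \<le> x \<Longrightarrow> 0 \<le> q x"
  obtains \<phi> :: "'a \<Rightarrow>\<^sub>L real" where "\<And>x. 0 \<le> x \<Longrightarrow> \<phi> x = q x"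
proof -
  define f where "f x = q (pprt x) - q (pprt (- x))" for x :: 'a
  have q0: "q 0 = 0" using add[of 0 0] by simp
  \<comment> \<open>The value is independent of how an element is written as a difference of
    positive ones, so linearity only requires one convenient representation of a sum or a
    multiple.\<close>
  have fdiff: "f (a - b) = q a - q b" if "0 \<le> a" "0 \<le> b" for a b
  proof -
    have "pprt (a - b) + b = a + pprt (- (a - b))"
      using pprt_diff_pprt_uminus[of "a - b"] by (simp add: algebra_simps)
    then have "q (pprt (a - b)) + q b = q a + q (pprt (- (a - b)))"
      using add[of "pprt (a - b)" b] add[of a "pprt (- (a - b))"] that by simp
    then show ?thesis by (simp add: f_def)
  qed
  have hom: "q (t *\<^sub>R x) = t * q x" if "0 \<le> t" "0 \<le> x" for t x
    using additive_imp_homogeneous[of q t x] add nn that by blast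
  obtain C where C: "\<And>x. 0 \<le> x \<Longrightarrow> q x \<le> C * norm x"
    using additive_imp_bounded[of q] add nn by blast
  have "bounded_linear f"
  proof (rule bounded_linear_intro)
    fix x y :: 'a
    have "x + y = (pprt x + pprt y) - (pprt (-x) + pprt (-y))"
      using pprt_diff_pprt_uminus[of x] pprt_diff_pprt_uminus[of y] by (simp add: algebra_simps)
    then have "f (x + y) = q (pprt x + pprt y) - q (pprt (-x) + pprt (-y))"
      using fdiff[of "pprt x + pprt y" "pprt (-x) + pprt (-y)"] by simp
    then show "f (x + y) = f x + f y"
      by (simp add: add f_def)
  next
    fix r and x :: 'a
    show "f (r *\<^sub>R x) = r *\<^sub>R f x"
    proof (cases "0 \<le> r")
      case True
      have "r *\<^sub>R x = r *\<^sub>R pprt x - r *\<^sub>R pprt (-x)"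
        by (simp only: pprt_diff_pprt_uminus flip: scaleR_right_diff_distrib)
      then have "f (r *\<^sub>R x) = q (r *\<^sub>R pprt x) - q (r *\<^sub>R pprt (-x))"
        using fdiff[of "r *\<^sub>R pprt x" "r *\<^sub>R pprt (-x)"] True
        by (simp only: scaleR_nonneg_nonneg zero_le_pprt)
      then show ?thesis using True by (simp add: hom f_def algebra_simps)
    next
      case False
      have "r *\<^sub>R x = (- r) *\<^sub>R pprt (-x) - (- r) *\<^sub>R pprt x"
        using arg_cong[OF pprt_diff_pprt_uminus[of x], of "\<lambda>u. r *\<^sub>R u"] by (simp add: scaleR_right_diff_distrib)
      then have "f (r *\<^sub>R x) = q ((-r) *\<^sub>R pprt (-x)) - q ((-r) *\<^sub>R pprt x)"
        using fdiff[of "(- r) *\<^sub>R pprt (-x)" "(- r) *\<^sub>R pprt x"] False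
        by (simp only: scaleR_nonneg_nonneg zero_le_pprt neg_0_le_iff_le linear not_le less_imp_le)
      then show ?thesis using False hom[of "-r"] by (simp add: f_def algebra_simps)
    qed
  next
    fix x :: 'a
    have "q (pprt y) \<le> \<bar>C\<bar> * norm y" for y
    proof -
      have "q (pprt y) \<le> C * norm (pprt y)" by (simp add: C)
      also have "\<dots> \<le> \<bar>C\<bar> * norm y"
        using norm_pprt_le[of y] by (intro mult_mono) auto
      finally show ?thesis .
    qed
    from this[of x] this[of "- x"] show "norm (f x) \<le> norm x * \<bar>C\<bar>"
      using nn[of "pprt x"] nn[of "pprt (- x)"] by (simp add: f_def mult.commute abs_le_iff)
  qed
  then have "blinfun_apply (Blinfun f) = f"
    by (rule bounded_linear_Blinfun_apply)
  moreover have "f x = q x" if "0 \<le> x" for x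
    using that by (simp add: f_def q0)
  ultimately show thesis using that by metis
qed

section \<open>Sums over finite partitions of a positive element\<close>

text \<open>Riesz decomposition cuts each entry of \<open>zs\<close> into a piece for
  \<open>x\<close> and a piece for \<open>y\<close>; subadditivity of \<open>p\<close> ensures that
  cutting does not decrease the sum.\<close>

lemma partition_split:
  fixes p :: "'a::lattice_ab_group_add \<Rightarrow> real"
  assumes sub: "\<And>x y. 0 \<le> x \<Longrightarrow> 0 \<le> y \<Longrightarrow> p (x + y) \<le> p x + p y" and p0: "p 0 = 0"
  shows "list_all ((\<le>) 0) zs \<Longrightarrow> sum_list zs = x + y \<Longrightarrow> 0 \<le> x \<Longrightarrow> 0 \<le> y \<Longrightarrow>
    \<exists>xs ys. list_all ((\<le>) 0) xs \<and> sum_list xs = x \<and> list_all ((\<le>) 0) ys \<and> sum_list ys = y \<and>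
      sum_list (map p zs) \<le> sum_list (map p xs) + sum_list (map p ys)"
proof (induction zs arbitrary: x y)
  case Nil
  then have "x = 0" "y = 0" by (auto simp: add_nonneg_eq_0_iff)
  then show ?case by (intro exI[of _ "[]"]) auto
next
  case (Cons z zs)
  have z: "0 \<le> z" "0 \<le> sum_list zs"
    using Cons.prems(1) by (auto simp: list_all_iff intro!: sum_list_nonneg)
  then have "z \<le> x + y"
    using Cons.prems(2) by (metis le_add_same_cancel1 sum_list.Cons)
  then obtain a b where ab: "z = a + b" "0 \<le> a" "a \<le> x" "0 \<le> b" "b \<le> y"
    using riesz_decomposition[of x y z] z Cons.prems by metis
  have "sum_list zs = (x - a) + (y - b)"
    using Cons.prems(2) ab by (simp add: algebra_simps) 
  then obtain xs ys where xs: "list_all ((\<le>) 0) xs" "sum_list xs = x - a"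
      "list_all ((\<le>) 0) ys" "sum_list ys = y - b"
      "sum_list (map p zs) \<le> sum_list (map p xs) + sum_list (map p ys)"
    using Cons.IH[of "x - a" "y - b"] Cons.prems ab by auto
  have "p z \<le> p a + p b" using sub ab by simp
  with xs ab show ?case
    by (intro exI[of _ "a # xs"] exI[of _ "b # ys"]) auto
qed

text \<open>The witness is the supremum of the sums of p over all finite partitions of x
  into positive elements; the last clause records this minimality.\<close>

lemma least_additive_majorant:
  fixes p :: "'a::banach_lattice \<Rightarrow> real"
  assumes sub: "\<And>x y. 0 \<le> x \<Longrightarrow> 0 \<le> y \<Longrightarrow> p (x + y) \<le> p x + p y" and p0: "p 0 = 0"
    and nn: "\<And>x. 0 \<le> x \<Longrightarrow> 0 \<le> p x"
    and bd: "\<And>x. 0 \<le> x \<Longrightarrow>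
      \<exists>M. \<forall>xs. list_all ((\<le>) 0) xs \<and> sum_list xs = x \<longrightarrow> sum_list (map p xs) \<le> M"
  shows "\<exists>\<phi> :: 'a \<Rightarrow>\<^sub>L real. \<forall>x. 0 \<le> x \<longrightarrow> p x \<le> \<phi> x \<and>
    (\<forall>M. (\<forall>xs. list_all ((\<le>) 0) xs \<longrightarrow> sum_list xs = x \<longrightarrow> sum_list (map p xs) \<le> M) \<longrightarrow> \<phi> x \<le> M)"
proof -
  define S where "S x = {sum_list (map p xs) | xs. list_all ((\<le>) 0) xs \<and> sum_list xs = x}" for x
  define q where "q x = Sup (S x)" for x
  have bdS: "bdd_above (S x)" if "0 \<le> x" for x
    using bd[OF that] unfolding S_def bdd_above_def by blast
  have pS: "p x \<in> S x" if "0 \<le> x" for x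
    unfolding S_def using that by (auto intro!: exI[of _ "[x]"])
  have ne: "S x \<noteq> {}" if "0 \<le> x" for x using pS[OF that] by blast
  have pq: "p x \<le> q x" if "0 \<le> x" for x
    unfolding q_def using pS bdS that by (intro cSup_upper) auto
  have "q (x + y) = q x + q y" if xy: "0 \<le> x" "0 \<le> y" for x y
  proof (rule antisym)
    show "q (x + y) \<le> q x + q y"
      unfolding q_def[of "x + y"]
    proof (rule cSup_least)
      fix s assume "s \<in> S (x + y)"
      then obtain zs where zs: "list_all ((\<le>) 0) zs" "sum_list zs = x + y" "s = sum_list (map p zs)"
        by (auto simp: S_def)
      obtain xs ys where "list_all ((\<le>) 0) xs" "sum_list xs = x"
        "list_all ((\<le>) 0) ys" "sum_list ys = y"
        and le: "sum_list (map p zs) \<le> sum_list (map p xs) + sum_list (map p ys)"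
        using partition_split[of p zs x y] sub p0 zs xy by blast
      then have "sum_list (map p xs) \<in> S x" "sum_list (map p ys) \<in> S y"
        by (auto simp: S_def)
      then have "sum_list (map p xs) \<le> q x" "sum_list (map p ys) \<le> q y"
        unfolding q_def using bdS xy by (auto intro!: cSup_upper)
      with le zs show "s \<le> q x + q y" by simp
    qed (use ne xy in auto)
    have "s + t \<le> q (x + y)" if s: "s \<in> S x" and t: "t \<in> S y" for s t
    proof -
      obtain xs ys where xs: "list_all ((\<le>) 0) xs" "sum_list xs = x" "s = sum_list (map p xs)"
        and ys: "list_all ((\<le>) 0) ys" "sum_list ys = y" "t = sum_list (map p ys)"
        using s t by (auto simp: S_def)
      have "s + t \<in> S (x + y)"
        unfolding S_def using xs ys by (auto intro!: exI[of _ "xs @ ys"])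
      then show ?thesis
        unfolding q_def using bdS xy by (intro cSup_upper) auto
    qed
    then have "s \<le> q (x + y) - t" if "s \<in> S x" "t \<in> S y" for s t
      using that by (simp add: le_diff_eq)
    then have "q x \<le> q (x + y) - t" if "t \<in> S y" for t
      unfolding q_def[of x] using that ne xy by (intro cSup_least) auto
    then have "t \<le> q (x + y) - q x" if "t \<in> S y" for t
      using that by (simp add: le_diff_eq add.commute)
    then have "q y \<le> q (x + y) - q x"
      unfolding q_def[of y] using ne xy by (intro cSup_least) auto
    then show "q x + q y \<le> q (x + y)" by simp
  qed
  moreover have "0 \<le> q x" if "0 \<le> x" for x
    using pq[OF that] nn[OF that] by simp
  ultimately obtain \<phi> :: "'a \<Rightarrow>\<^sub>L real" where \<phi>: "\<And>x. 0 \<le> x \<Longrightarrow> \<phi> x = q x"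
    using additive_extend by blast
  show ?thesis
  proof (intro exI allI impI conjI)
    fix x :: 'a assume x: "0 \<le> x"
    then show "p x \<le> \<phi> x" using pq \<phi> by simp
    fix M assume "\<forall>xs. list_all ((\<le>) 0) xs \<longrightarrow> sum_list xs = x \<longrightarrow> sum_list (map p xs) \<le> M"
    then show "\<phi> x \<le> M"
      unfolding \<phi>[OF x] q_def using ne[OF x] by (intro cSup_least) (auto simp: S_def)
  qed
qed

text \<open>A sum of moduli is a supremum over choices of signs, and each choice of signs gives
  \<open>T y\<close> with \<open>y\<close> between minus and plus the sum of \<open>xs\<close>. The
  accumulator \<open>c\<close> holds the signed terms already chosen, which lets the induction
  handle one entry at a time without listing the sign patterns.\<close>

lemma sum_list_labs_le:
  fixes T :: "'a::lattice_ab_group_add \<Rightarrow> 'b::lattice_ab_group_add"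
  assumes add: "\<And>x y. T (x + y) = T x + T y" and minus: "\<And>x. T (- x) = - T x"
  shows "list_all ((\<le>) 0) xs \<Longrightarrow> (\<And>y. - sum_list xs \<le> y \<Longrightarrow> y \<le> sum_list xs \<Longrightarrow> c + T y \<le> z) \<Longrightarrow>
    c + sum_list (map (\<lambda>x. labs (T x)) xs) \<le> z"
proof (induction xs arbitrary: c)
  case Nil
  have "T 0 = 0" using add[of 0 0] by simp
  then show ?case using Nil(2)[of 0] by simp
next
  case (Cons x xs)
  let ?s = "sum_list (map (\<lambda>x. labs (T x)) xs)"
  have x: "0 \<le> x" "list_all ((\<le>) 0) xs" using Cons.prems(1) by auto
  have "(c + T x) + ?s \<le> z"
  proof (rule Cons.IH[OF x(2)])
    fix y assume y: "- sum_list xs \<le> y" "y \<le> sum_list xs"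
    have "c + T (x + y) \<le> z"
    proof (rule Cons.prems(2))
      show "- sum_list (x # xs) \<le> x + y"
        using add_mono[OF y(1), of "- x" x] x(1) by (simp add: algebra_simps minus_le_self_iff)
      show "x + y \<le> sum_list (x # xs)" using y by simp
    qed
    then show "c + T x + T y \<le> z" by (simp add: add add.assoc)
  qed
  moreover have "(c - T x) + ?s \<le> z"
  proof (rule Cons.IH[OF x(2)])
    fix y assume y: "- sum_list xs \<le> y" "y \<le> sum_list xs"
    have "c + T (- x + y) \<le> z"
    proof (rule Cons.prems(2))
      show "- sum_list (x # xs) \<le> - x + y" using y by simp
      have "- x + y \<le> x + sum_list xs"
        using y x by (intro add_mono) (auto simp: minus_le_self_iff)
      then show "- x + y \<le> sum_list (x # xs)" by simp
    qed
    then show "c - T x + T y \<le> z"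
      unfolding add minus by (simp only: add.assoc[symmetric] add_uminus_conv_diff)
  qed
  ultimately have "sup (c + T x + ?s) (c - T x + ?s) \<le> z" by simp
  moreover have "sup (c + T x + ?s) (c - T x + ?s) = c + sup (T x) (- T x) + ?s"
    by (simp add: add_sup_distrib_left add_sup_distrib_right)
  ultimately have "c + labs (T x) + ?s \<le> z" by (simp only: labs_def)
  then show ?case by (simp add: add.assoc)
qed


section \<open>The dual Banach lattice\<close>

lemma labs_real: "labs (x::real) = \<bar>x\<bar>"
  by (simp add: labs_def sup_real_def)

text \<open>The modulus at \<open>x\<close> is the supremum of the sums of
  \<open>\<bar>f x\<bar>\<close> over partitions of \<open>x\<close> (Riesz-Kantorovich). Choosing
  signs turns such a sum into a value \<open>f y\<close> with the modulus of \<open>y\<close> below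
  \<open>x\<close>, whence the norm bound, which later makes the dual norm a lattice norm.\<close>

lemma dual_abs_exists:
  fixes f :: "'b::banach_lattice \<Rightarrow>\<^sub>L real"
  shows "\<exists>h. dual_abs h f \<and> (\<forall>x. 0 \<le> x \<longrightarrow> h x \<le> norm f * norm x)"
proof -
  have bound: "sum_list (map (\<lambda>x. \<bar>f x\<bar>) xs) \<le> norm f * norm (sum_list xs)"
    if "list_all ((\<le>) 0) xs" for xs
  proof -
    have "0 + sum_list (map (\<lambda>x. labs (f x)) xs) \<le> norm f * norm (sum_list xs)"
    proof (rule sum_list_labs_le)
      fix y assume y: "- sum_list xs \<le> y" "y \<le> sum_list xs"
      have "sup y (- y) \<le> sup (sum_list xs) (- sum_list xs)"
        using y by (intro le_supI le_supI1) (simp_all add: minus_le_iff)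
      then have "norm y \<le> norm (sum_list xs)"
        by (rule lattice_norm)
      moreover have "f y \<le> norm f * norm y"
        using norm_blinfun[of f y] by simp
      ultimately show "0 + f y \<le> norm f * norm (sum_list xs)"
        using mult_left_mono[of "norm y" "norm (sum_list xs)" "norm f"] by simp
    qed (use that in \<open>auto simp: blinfun.bilinear_simps\<close>)
    then show ?thesis by (simp add: labs_real)
  qed
  have "\<exists>h :: 'b \<Rightarrow>\<^sub>L real. \<forall>x. 0 \<le> x \<longrightarrow> \<bar>f x\<bar> \<le> h x \<and>
    (\<forall>M. (\<forall>xs. list_all ((\<le>) 0) xs \<longrightarrow> sum_list xs = x \<longrightarrow> sum_list (map (\<lambda>x. \<bar>f x\<bar>) xs) \<le> M)
      \<longrightarrow> h x \<le> M)"
  proof (rule least_additive_majorant[of "\<lambda>x. \<bar>f x\<bar>"])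
    show "\<bar>f (x + y)\<bar> \<le> \<bar>f x\<bar> + \<bar>f y\<bar>" for x y
      by (simp add: blinfun.add_right abs_triangle_ineq)
    show "\<exists>M. \<forall>xs. list_all ((\<le>) 0) xs \<and> sum_list xs = x \<longrightarrow> sum_list (map (\<lambda>x. \<bar>f x\<bar>) xs) \<le> M"
      for x using bound by (intro exI[of _ "norm f * norm x"]) auto
  qed simp_all
  then obtain h :: "'b \<Rightarrow>\<^sub>L real" where h: "\<And>x. 0 \<le> x \<Longrightarrow> \<bar>f x\<bar> \<le> h x"
    "\<And>x M. 0 \<le> x \<Longrightarrow> \<forall>xs. list_all ((\<le>) 0) xs \<longrightarrow> sum_list xs = x \<longrightarrow>
           sum_list (map (\<lambda>x. \<bar>f x\<bar>) xs) \<le> M \<Longrightarrow> h x \<le> M"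
    by blast
  have "dual_le h k" if k: "dual_le f k" "dual_le (- f) k" for k
    unfolding dual_le_def
  proof (intro allI impI h(2))
    fix x :: 'b and xs assume xs: "list_all ((\<le>) 0) xs" "sum_list xs = x"
    have "sum_list (map (\<lambda>x. \<bar>f x\<bar>) xs) \<le> sum_list (map (blinfun_apply k) xs)"
      using xs(1) k by (intro sum_list_mono) (auto simp: dual_le_def list_all_iff blinfun.bilinear_simps abs_le_iff)
    also have "\<dots> = k (sum_list xs)"
      by (induction xs) (auto simp: blinfun.bilinear_simps)
    finally show "sum_list (map (\<lambda>x. \<bar>f x\<bar>) xs) \<le> k x" using xs by simp
  qed
  moreover have "dual_le f h" "dual_le (- f) h"
    using h(1) by (auto simp: dual_le_def blinfun.bilinear_simps abs_le_iff)
  moreover have "h x \<le> norm f * norm x" if "0 \<le> x" for x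
    using that bound by (intro h(2)) auto
  ultimately show ?thesis by (auto simp: dual_abs_def)
qed

text \<open>A copy of the type of bounded functionals: an instance declaration for the original type would
  have to fix its codomain to the reals, which type classes do not permit.\<close>

typedef (overloaded) 'b dual = "UNIV :: ('b::banach_lattice \<Rightarrow>\<^sub>L real) set"
  morphisms of_dual to_dual ..

declare to_dual_inverse[OF UNIV_I, simp] of_dual_inverse[simp]

instantiation dual :: (banach_lattice) real_normed_vector
begin

definition "0 = to_dual 0"
definition "f + g = to_dual (of_dual f + of_dual g)"
definition "f - g = to_dual (of_dual f - of_dual g)"
definition "- f = to_dual (- of_dual f)"
definition "r *\<^sub>R f = to_dual (r *\<^sub>R of_dual f)"
definition "norm f = norm (of_dual f)"
definition "dist f g = dist (of_dual f) (of_dual g)" for f g :: "'a dual"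
definition "sgn f = to_dual (sgn (of_dual f))"
definition "uniformity = (INF e\<in>{0<..}. principal {(f, g :: 'a dual). dist f g < e})"
definition "open U = (\<forall>f\<in>U. \<forall>\<^sub>F (f', g) in uniformity. f' = f \<longrightarrow> (g :: 'a dual) \<in> U)"

instance
proof
  fix f g h :: "'a dual" and r s :: real
  show "f + g + h = f + (g + h)" "f + g = g + f" "0 + f = f" "- f + f = 0" "f - g = f + - g"
    "r *\<^sub>R (f + g) = r *\<^sub>R f + r *\<^sub>R g" "(r + s) *\<^sub>R f = r *\<^sub>R f + s *\<^sub>R f"
    "r *\<^sub>R s *\<^sub>R f = (r * s) *\<^sub>R f" "1 *\<^sub>R f = f"
    by (simp_all add: zero_dual_def plus_dual_def minus_dual_def uminus_dual_def scaleR_dual_def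
        algebra_simps)
  show "dist f g = norm (f - g)" "sgn f = inverse (norm f) *\<^sub>R f"
    by (simp_all add: dist_dual_def norm_dual_def sgn_dual_def minus_dual_def scaleR_dual_def
        dist_norm sgn_div_norm)
  show "norm f = 0 \<longleftrightarrow> f = 0"
    by (metis norm_dual_def norm_eq_zero of_dual_inverse to_dual_inverse UNIV_I zero_dual_def)
  show "norm (f + g) \<le> norm f + norm g" "norm (r *\<^sub>R f) = \<bar>r\<bar> * norm f"
    by (simp_all add: norm_dual_def plus_dual_def scaleR_dual_def norm_triangle_ineq)
qed (rule uniformity_dual_def open_dual_def)+

end

lemma of_dual_simps [simp]:
  "of_dual 0 = 0" "of_dual (f + g) = of_dual f + of_dual g" "of_dual (f - g) = of_dual f - of_dual g"
  "of_dual (- f) = - of_dual f" "of_dual (r *\<^sub>R f) = r *\<^sub>R of_dual f" "norm (of_dual f) = norm f"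
  by (simp_all add: zero_dual_def plus_dual_def minus_dual_def uminus_dual_def scaleR_dual_def
        norm_dual_def)

lemma bounded_linear_of_dual: "bounded_linear (of_dual :: 'b::banach_lattice dual \<Rightarrow> _)"
  by (rule bounded_linear_intro[of _ 1]) auto

lemma bounded_linear_to_dual: "bounded_linear (to_dual :: ('b::banach_lattice \<Rightarrow>\<^sub>L real) \<Rightarrow> _)"
  by (rule bounded_linear_intro[of _ 1]) (auto simp: plus_dual_def scaleR_dual_def norm_dual_def)

instance dual :: (banach_lattice) banach
proof
  fix X :: "nat \<Rightarrow> 'a dual" assume "Cauchy X"
  then have "Cauchy (\<lambda>n. of_dual (X n))"
    by (rule bounded_linear.Cauchy[OF bounded_linear_of_dual])
  then obtain L where "(\<lambda>n. of_dual (X n)) \<longlonglongrightarrow> L"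
    using Cauchy_convergent convergent_def by blast
  then have "(\<lambda>n. to_dual (of_dual (X n))) \<longlonglongrightarrow> to_dual L"
    by (rule bounded_linear.tendsto[OF bounded_linear_to_dual])
  then show "convergent X" by (auto simp: convergent_def)
qed

instantiation dual :: (banach_lattice) ordered_real_vector
begin

definition "f \<le> g \<longleftrightarrow> dual_le (of_dual f) (of_dual g)"
definition "f < g \<longleftrightarrow> f \<le> g \<and> \<not> g \<le> (f :: 'a dual)"

instance
proof
  fix f g h :: "'a dual" and r s :: real
  show "f < g \<longleftrightarrow> f \<le> g \<and> \<not> g \<le> f" by (rule less_dual_def)
  show "f \<le> f" by (simp add: less_eq_dual_def dual_le_def)
  show "f \<le> g \<Longrightarrow> g \<le> h \<Longrightarrow> f \<le> h"
    unfolding less_eq_dual_def dual_le_def by (meson order_trans)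
  show "f = g" if "f \<le> g" "g \<le> f"
  proof -
    have eq: "of_dual f x = of_dual g x" if "0 \<le> x" for x
      using \<open>f \<le> g\<close> \<open>g \<le> f\<close> that by (auto simp: less_eq_dual_def dual_le_def intro: antisym)
    have "of_dual f x = of_dual g x" for x
    proof -
      have "of_dual f (pprt x - pprt (- x)) = of_dual g (pprt x - pprt (- x))"
        using eq by (simp add: blinfun.bilinear_simps)
      then show ?thesis by (simp only: pprt_diff_pprt_uminus)
    qed
    then have "of_dual f = of_dual g" by (rule blinfun_eqI)
    then show ?thesis by (simp add: of_dual_inject)
  qed
  show "f \<le> g \<Longrightarrow> h + f \<le> h + g"
    by (simp add: less_eq_dual_def dual_le_def blinfun.bilinear_simps)
  show "f \<le> g \<Longrightarrow> 0 \<le> r \<Longrightarrow> r *\<^sub>R f \<le> r *\<^sub>R g"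
    by (simp add: less_eq_dual_def dual_le_def blinfun.bilinear_simps mult_left_mono)
  show "r *\<^sub>R f \<le> s *\<^sub>R f" if "r \<le> s" "0 \<le> f"
    using that by (simp add: less_eq_dual_def dual_le_def blinfun.bilinear_simps mult_right_mono)
qed

end

text \<open>Minimality determines the modulus uniquely; the norm estimate is packed into the choice
  merely to travel with it.\<close>

definition dual_modulus :: "'b::banach_lattice dual \<Rightarrow> 'b dual" where
  "dual_modulus f = to_dual (SOME h. dual_abs h (of_dual f) \<and>
     (\<forall>x. 0 \<le> x \<longrightarrow> h x \<le> norm f * norm x))"

lemma dual_modulus:
  shows dual_abs_dual_modulus: "dual_abs (of_dual (dual_modulus f)) (of_dual f)"
    and dual_modulus_bound: "0 \<le> x \<Longrightarrow> of_dual (dual_modulus f) x \<le> norm f * norm x"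
  using someI_ex[OF dual_abs_exists[of "of_dual f"]] by (auto simp: dual_modulus_def)

lemma dual_modulus_ge: "f \<le> dual_modulus f" "- f \<le> dual_modulus f"
  using dual_abs_dual_modulus[of f] by (auto simp: dual_abs_def less_eq_dual_def)

lemma dual_modulus_least: "f \<le> k \<Longrightarrow> - f \<le> k \<Longrightarrow> dual_modulus f \<le> k"
  using dual_abs_dual_modulus[of f] by (auto simp: dual_abs_def less_eq_dual_def)

instantiation dual :: (banach_lattice) banach_lattice
begin

text \<open>Binary suprema and infima are recovered from the modulus, the one supremum constructed
  so far.\<close>

definition "sup f g = (1/2) *\<^sub>R (f + g + dual_modulus (f - g))"
definition "inf f g = (1/2) *\<^sub>R (f + g - dual_modulus (f - g))"

lemma half_scaleR_le: "x + x \<le> y \<Longrightarrow> x \<le> (1/2) *\<^sub>R (y :: 'a dual)"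
  using scaleR_left_mono[of "x + x" y "1/2"] by (simp flip: scaleR_2)

lemma half_scaleR_ge: "y \<le> x + x \<Longrightarrow> (1/2) *\<^sub>R (y :: 'a dual) \<le> x"
  using scaleR_left_mono[of y "x + x" "1/2"] by (simp flip: scaleR_2)

instance
proof
  fix f g h :: "'a dual"
  have *: "f - g \<le> dual_modulus (f - g)" "g - f \<le> dual_modulus (f - g)"
    using dual_modulus_ge[of "f - g"] by auto
  show "inf f g \<le> f" "inf f g \<le> g" "f \<le> sup f g" "g \<le> sup f g"
    unfolding inf_dual_def sup_dual_def
    by (rule half_scaleR_ge half_scaleR_le, use * in \<open>simp add: algebra_simps\<close>)+
  show "f \<le> inf g h" if "f \<le> g" "f \<le> h"
  proof -
    have "dual_modulus (g - h) \<le> g + h - (f + f)"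
      by (rule dual_modulus_least)
        (use add_mono[OF that(1,1)] add_mono[OF that(2,2)] in \<open>simp_all add: algebra_simps\<close>)
    then show ?thesis
      unfolding inf_dual_def by (intro half_scaleR_le) (simp add: algebra_simps)
  qed
  show "sup g h \<le> f" if "g \<le> f" "h \<le> f"
  proof -
    have "dual_modulus (g - h) \<le> (f + f) - (g + h)"
      by (rule dual_modulus_least)
        (use add_mono[OF that(1,1)] add_mono[OF that(2,2)] in \<open>simp_all add: algebra_simps\<close>)
    then show ?thesis
      unfolding sup_dual_def by (intro half_scaleR_ge) (simp add: algebra_simps)
  qed
next
  fix f g :: "'a dual"
  have sup_eq: "sup f (- f) = dual_modulus f" for f :: "'a dual"
  proof (rule order.antisym)
    have *: "f + f \<le> dual_modulus f + dual_modulus f" "- f - f \<le> dual_modulus f + dual_modulus f"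
      using add_mono[OF dual_modulus_ge(1) dual_modulus_ge(1), of f f]
        add_mono[OF dual_modulus_ge(2) dual_modulus_ge(2), of f f] by auto
    then have "dual_modulus (f - - f) \<le> dual_modulus f + dual_modulus f"
      by (intro dual_modulus_least) auto
    then show "sup f (- f) \<le> dual_modulus f"
      unfolding sup_dual_def by (intro half_scaleR_ge) simp
    have "f + f \<le> dual_modulus (f - - f)" "- f - f \<le> dual_modulus (f - - f)"
      using dual_modulus_ge[of "f - - f"] by auto
    then have "f \<le> (1/2) *\<^sub>R dual_modulus (f - - f)" "- f \<le> (1/2) *\<^sub>R dual_modulus (f - - f)"
      by (auto intro!: half_scaleR_le)
    then show "dual_modulus f \<le> sup f (- f)"
      unfolding sup_dual_def by (intro dual_modulus_least) auto
  qed
  assume "sup f (- f) \<le> sup g (- g)"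
  then have le: "dual_modulus f \<le> dual_modulus g" by (simp add: sup_eq)
  have "norm (of_dual f) \<le> norm g"
  proof (rule norm_blinfun_bound)
    fix x :: 'a
    have pos: "\<bar>of_dual f y\<bar> \<le> of_dual (dual_modulus f) y" if "0 \<le> y" for y
      using dual_modulus_ge[of f] that
      by (auto simp: less_eq_dual_def dual_le_def abs_le_iff blinfun.bilinear_simps)
    have "of_dual f x = of_dual f (pprt x) - of_dual f (pprt (- x))"
      by (simp only: pprt_diff_pprt_uminus flip: blinfun.diff_right)
    then have "\<bar>of_dual f x\<bar> \<le> of_dual (dual_modulus f) (pprt x) + of_dual (dual_modulus f) (pprt (- x))"
      using pos[of "pprt x"] pos[of "pprt (- x)"] by simp
    also have "\<dots> = of_dual (dual_modulus f) (labs x)"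
      by (simp only: pprt_add_pprt_uminus flip: blinfun.add_right)
    also have "\<dots> \<le> of_dual (dual_modulus g) (labs x)"
      using le labs_nonneg[of x] by (auto simp: less_eq_dual_def dual_le_def)
    also have "\<dots> \<le> norm g * norm (labs x)"
      by (rule dual_modulus_bound[OF labs_nonneg])
    finally show "norm (of_dual f x) \<le> norm g * norm x" by (simp add: norm_labs)
  qed simp
  then show "norm f \<le> norm g" by simp
qed

end

lemma dual_abs_iff: "dual_abs (of_dual h) (of_dual f) \<longleftrightarrow> h = labs f"
proof
  assume "dual_abs (of_dual h) (of_dual f)"
  then have "f \<le> h" "- f \<le> h" "\<And>k. f \<le> k \<Longrightarrow> - f \<le> k \<Longrightarrow> h \<le> k"
    by (auto simp: dual_abs_def less_eq_dual_def)
  then show "h = labs f"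
    by (intro order.antisym) (auto simp: labs_ge, auto simp: labs_def)
next
  assume h: "h = labs f"
  have "dual_le (of_dual h) k" if "dual_le (of_dual f) k" "dual_le (- of_dual f) k" for k
    using that less_eq_dual_def[of f "to_dual k"] less_eq_dual_def[of "- f" "to_dual k"]
      less_eq_dual_def[of h "to_dual k"] by (simp add: h labs_def)
  then show "dual_abs (of_dual h) (of_dual f)"
    using labs_ge[of f] by (auto simp: dual_abs_def h less_eq_dual_def)
qed

lemma dual_disjointI:
  assumes "inf (labs f) (labs g) = 0"
  shows "dual_disjoint (of_dual f) (of_dual g)"
  unfolding dual_disjoint_def
proof (intro exI conjI allI impI)
  show "dual_abs (of_dual (labs f)) (of_dual f)" "dual_abs (of_dual (labs g)) (of_dual g)"
    by (simp_all add: dual_abs_iff)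
  show "dual_le 0 (of_dual (labs f))" "dual_le 0 (of_dual (labs g))"
    using labs_nonneg[of f] labs_nonneg[of g] by (simp_all add: less_eq_dual_def)
  fix k assume "dual_le k (of_dual (labs f)) \<and> dual_le k (of_dual (labs g))"
  then have "to_dual k \<le> labs f" "to_dual k \<le> labs g" by (simp_all add: less_eq_dual_def)
  then have "to_dual k \<le> inf (labs f) (labs g)" by (rule le_infI)
  then show "dual_le k 0" using assms by (simp add: less_eq_dual_def)
qed

lemma weakly_null_bounded_linear:
  assumes "bounded_linear L" "weakly_null x"
  shows "weakly_null (\<lambda>n. L (x n))"
  unfolding weakly_null_def
proof
  fix \<phi> :: "'b \<Rightarrow>\<^sub>L real"
  show "(\<lambda>n. \<phi> (L (x n))) \<longlonglongrightarrow> 0"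
    using assms(2)[unfolded weakly_null_def, rule_format, of "\<phi> o\<^sub>L Blinfun L"]
    by (simp add: bounded_linear_Blinfun_apply[OF assms(1)])
qed

lemma weakly_null_of_dual: "weakly_null f \<Longrightarrow> weakly_null (\<lambda>n. of_dual (f n))"
  by (rule weakly_null_bounded_linear[OF bounded_linear_of_dual])

lemma weakly_null_to_dual: "weakly_null f \<Longrightarrow> weakly_null (\<lambda>n. to_dual (f n))"
  by (rule weakly_null_bounded_linear[OF bounded_linear_to_dual])

lemma dual_swclo_imp_swclo:
  assumes "dual_swclo TYPE('b::banach_lattice)"
  shows "swclo TYPE('b dual)"
  unfolding swclo_def
proof (intro allI impI)
  fix f :: "nat \<Rightarrow> 'b dual" assume "weakly_null f"
  then have "weakly_null (\<lambda>n. of_dual (labs (f n)))"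
    using assms[unfolded dual_swclo_def, rule_format,
        of "\<lambda>n. of_dual (f n)" "\<lambda>n. of_dual (labs (f n))"]
    by (simp add: weakly_null_of_dual dual_abs_iff)
  from weakly_null_to_dual[OF this] show "weakly_null (\<lambda>n. labs (f n))" by simp
qed

lemma blinfun_diff_of_positive:
  fixes \<phi> :: "'b::banach_lattice \<Rightarrow>\<^sub>L real"
  shows "\<exists>\<alpha> \<beta> :: 'b \<Rightarrow>\<^sub>L real. \<phi> = \<alpha> - \<beta> \<and> (\<forall>x\<ge>0. 0 \<le> \<alpha> x) \<and> (\<forall>x\<ge>0. 0 \<le> \<beta> x)"
proof (intro exI conjI)
  have *: "\<forall>x\<ge>0. 0 \<le> of_dual (pprt f) x" for f :: "'b dual"
    using zero_le_pprt[of f] by (simp only: less_eq_dual_def dual_le_def) simp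
  show "\<phi> = of_dual (pprt (to_dual \<phi>)) - of_dual (pprt (- to_dual \<phi>))"
    using arg_cong[OF pprt_diff_pprt_uminus[of "to_dual \<phi>"], of of_dual] by simp
  show "\<forall>x\<ge>0. 0 \<le> of_dual (pprt (to_dual \<phi>)) x" "\<forall>x\<ge>0. 0 \<le> of_dual (pprt (- to_dual \<phi>)) x"
    using * by auto
qed

lemma weakly_null_positiveI:
  fixes x :: "nat \<Rightarrow> 'a::banach_lattice"
  assumes "\<And>\<phi> :: 'a \<Rightarrow>\<^sub>L real. (\<And>z. 0 \<le> z \<Longrightarrow> 0 \<le> \<phi> z) \<Longrightarrow> (\<lambda>n. \<phi> (x n)) \<longlonglongrightarrow> 0"
  shows "weakly_null x"
  unfolding weakly_null_def
proof
  fix \<phi> :: "'a \<Rightarrow>\<^sub>L real"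
  obtain \<alpha> \<beta> :: "'a \<Rightarrow>\<^sub>L real" where \<phi>: "\<phi> = \<alpha> - \<beta>"
    and pos: "\<And>x. 0 \<le> x \<Longrightarrow> 0 \<le> \<alpha> x" "\<And>x. 0 \<le> x \<Longrightarrow> 0 \<le> \<beta> x"
    using blinfun_diff_of_positive[of \<phi>] by blast
  show "(\<lambda>n. \<phi> (x n)) \<longlonglongrightarrow> 0"
    using tendsto_diff[OF assms[OF pos(1)] assms[OF pos(2)]] by (simp add: \<phi> blinfun.diff_left)
qed


section \<open>Boundedness of weakly null sequences\<close>

text \<open>One inequality encodes positive homogeneity: for \<open>t > 0\<close> the reverse one
  follows by applying it with the inverse factor, and \<open>t = 0\<close> gives
  \<open>p 0 = 0\<close>.\<close>

definition sublinear :: "('a::real_vector \<Rightarrow> real) \<Rightarrow> bool" where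
  "sublinear p \<longleftrightarrow> (\<forall>x y. p (x + y) \<le> p x + p y) \<and> (\<forall>t x. 0 \<le> t \<longrightarrow> p (t *\<^sub>R x) \<le> t * p x)"

lemma sublinear_lower:
  assumes "sublinear p"
  shows "p 0 = 0" "- p (- x) \<le> p x"
proof -
  have "p (0 *\<^sub>R x) \<le> 0 * p x" "p (0 + 0) \<le> p 0 + p 0"
    using assms unfolding sublinear_def by blast+
  then show 0: "p 0 = 0" by simp
  have "p (x + - x) \<le> p x + p (- x)"
    using assms unfolding sublinear_def by blast
  with 0 show "- p (- x) \<le> p x" by simp
qed

text \<open>Lowers p at \<open>-y\<close> as far as sublinearity permits; a minimal sublinear functional is therefore
  odd, hence linear.\<close>

definition sublinear_descent :: "('a::real_vector \<Rightarrow> real) \<Rightarrow> 'a \<Rightarrow> 'a \<Rightarrow> real" where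
  "sublinear_descent p y x = (INF t\<in>{0..}. p (x + t *\<^sub>R y) - t * p y)"

text \<open>The point is that the infimum is taken over a set bounded below: subadditivity and
  homogeneity give the bound \<open>- p (- x)\<close>, uniformly in \<open>t\<close>.\<close>

lemma sublinear_descent_le:
  assumes p: "sublinear p" and t: "0 \<le> t"
  shows "sublinear_descent p y x \<le> p (x + t *\<^sub>R y) - t * p y"
proof -
  have "- p (- x) \<le> p (x + t *\<^sub>R y) - t * p y" if "0 \<le> t" for t
  proof -
    have "p ((x + t *\<^sub>R y) + - x) \<le> p (x + t *\<^sub>R y) + p (- x)"
      using p unfolding sublinear_def by blast
    moreover have "t * p y \<le> p (t *\<^sub>R y)"
    proof (cases "t = 0")
      case True
      then show ?thesis using sublinear_lower[OF p] by simp
    next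
      case False
      have "p (inverse t *\<^sub>R (t *\<^sub>R y)) \<le> inverse t * p (t *\<^sub>R y)"
        using p that unfolding sublinear_def by (metis inverse_nonnegative_iff_nonnegative)
      then show ?thesis using False that by (simp add: field_simps)
    qed
    ultimately show ?thesis by simp
  qed
  then have "bdd_below ((\<lambda>t. p (x + t *\<^sub>R y) - t * p y) ` {0..})"
    by (intro bdd_belowI[of _ "- p (- x)"]) auto
  then show ?thesis
    unfolding sublinear_descent_def using t by (intro cINF_lower) auto
qed

text \<open>Parameters combine like the vectors: \<open>s\<close> for \<open>x\<close> and
  \<open>t\<close> for \<open>z\<close> give the competitor \<open>s + t\<close> for the sum, and
  \<open>t\<close> for \<open>x\<close> gives \<open>r * t\<close> for
  \<open>r *\<^sub>R x\<close>.\<close>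

lemma sublinear_sublinear_descent:
  assumes p: "sublinear p"
  shows "sublinear (sublinear_descent p y)"
  unfolding sublinear_def
proof (intro conjI allI impI)
  let ?q = "sublinear_descent p y"
  fix x z
  have *: "?q (x + z) \<le> (p (x + s *\<^sub>R y) - s * p y) + (p (z + t *\<^sub>R y) - t * p y)"
    if "0 \<le> s" "0 \<le> t" for s t
  proof -
    have "?q (x + z) \<le> p ((x + z) + (s + t) *\<^sub>R y) - (s + t) * p y"
      using that by (intro sublinear_descent_le[OF p]) auto
    also have "(x + z) + (s + t) *\<^sub>R y = (x + s *\<^sub>R y) + (z + t *\<^sub>R y)"
      by (simp add: algebra_simps)
    also have "p \<dots> \<le> p (x + s *\<^sub>R y) + p (z + t *\<^sub>R y)"
      using p unfolding sublinear_def by blast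
    finally show ?thesis by (simp add: algebra_simps)
  qed
  have "?q (x + z) - (p (z + t *\<^sub>R y) - t * p y) \<le> ?q x" if "0 \<le> t" for t
    unfolding sublinear_descent_def[of p y x]
  proof (rule cINF_greatest)
    fix s :: real assume "s \<in> {0..}"
    then show "?q (x + z) - (p (z + t *\<^sub>R y) - t * p y) \<le> p (x + s *\<^sub>R y) - s * p y"
      using *[of s t] that by simp
  qed simp
  then have "?q (x + z) - ?q x \<le> p (z + t *\<^sub>R y) - t * p y" if "0 \<le> t" for t
    using that by (simp add: algebra_simps)
  then have "?q (x + z) - ?q x \<le> ?q z"
    unfolding sublinear_descent_def[of p y z] by (intro cINF_greatest) auto
  then show "?q (x + z) \<le> ?q x + ?q z" by simp
next
  let ?q = "sublinear_descent p y"
  fix r :: real and x assume r: "0 \<le> r"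
  show "?q (r *\<^sub>R x) \<le> r * ?q x"
  proof (cases "r = 0")
    case True
    have "?q 0 \<le> p (0 + 0 *\<^sub>R y) - 0 * p y"
      by (rule sublinear_descent_le[OF p]) simp
    with True show ?thesis using sublinear_lower[OF p] by simp
  next
    case False
    with r have r: "0 < r" by simp
    have "inverse r * ?q (r *\<^sub>R x) \<le> ?q x"
      unfolding sublinear_descent_def[of p y x]
    proof (rule cINF_greatest)
      fix t :: real assume t: "t \<in> {0..}"
      have "?q (r *\<^sub>R x) \<le> p (r *\<^sub>R x + (r * t) *\<^sub>R y) - (r * t) * p y"
        using r t by (intro sublinear_descent_le[OF p]) auto
      also have "r *\<^sub>R x + (r * t) *\<^sub>R y = r *\<^sub>R (x + t *\<^sub>R y)"
        by (simp add: algebra_simps)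
      also have "p \<dots> \<le> r * p (x + t *\<^sub>R y)"
        using p r unfolding sublinear_def by (meson less_imp_le)
      finally show "inverse r * ?q (r *\<^sub>R x) \<le> p (x + t *\<^sub>R y) - t * p y"
        using r by (simp add: field_simps)
    qed simp
    then show ?thesis using r by (simp add: field_simps)
  qed
qed

text \<open>Zorn's lemma with pointwise infima of chains. These are finite because every sublinear
  functional below \<open>p\<close> is at least \<open>- p (- x)\<close> at \<open>x\<close>, and
  subadditive because of two members of a chain the smaller one bounds both summands.\<close>

lemma sublinear_minimal_exists:
  fixes p :: "'a::real_vector \<Rightarrow> real"
  assumes p: "sublinear p"
  shows "\<exists>m. sublinear m \<and> (\<forall>x. m x \<le> p x) \<and>
    (\<forall>q. sublinear q \<longrightarrow> (\<forall>x. q x \<le> m x) \<longrightarrow> q = m)"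
proof -
  define A where "A = {q. sublinear q \<and> (\<forall>x. q x \<le> p x)}"
  \<comment> \<open>The pointwise order is reversed, so that a maximal element in the sense of Zorn
    is a minimal functional.\<close>
  define P where "P a b \<longleftrightarrow> (\<forall>x. b x \<le> a x)" for a b :: "'a \<Rightarrow> real"
  have "\<exists>m\<in>A. \<forall>a\<in>A. P m a \<longrightarrow> a = m"
  proof (rule predicate_Zorn)
    show "partial_order_on A (relation_of P A)"
    proof (rule partial_order_on_relation_ofI)
      show "P a a" for a by (simp add: P_def)
      show "P a c" if "P a b" "P b c" for a b c
        using that unfolding P_def by (meson order_trans)
      show "a = b" if "P a b" "P b a" for a b
        using that unfolding P_def by (auto intro!: ext antisym)
    qed
    fix C assume C: "C \<in> Chains (relation_of P A)"
    then have CA: "C \<subseteq> A" and chain: "\<And>a b. a \<in> C \<Longrightarrow> b \<in> C \<Longrightarrow> P a b \<or> P b a"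
      by (auto simp: Chains_def relation_of_def)
    show "\<exists>u\<in>A. \<forall>a\<in>C. P a u"
    proof (cases "C = {}")
      case True
      then show ?thesis using p by (auto simp: A_def)
    next
      case False
      define u where "u x = (INF q\<in>C. q x)" for x
      have "- p (- x) \<le> q x" if "q \<in> C" for q x
      proof -
        have "- q (- x) \<le> q x" "q (- x) \<le> p (- x)"
          using that CA sublinear_lower(2)[of q x] by (auto simp: A_def)
        then show ?thesis by simp
      qed
      then have bdd: "bdd_below ((\<lambda>q. q x) ` C)" for x
        by (intro bdd_belowI[of _ "- p (- x)"]) auto
      have ule: "u x \<le> q x" if "q \<in> C" for q x
        unfolding u_def using that bdd by (intro cINF_lower) auto
      have sub: "q (x + y) \<le> q x + q y" "0 \<le> t \<Longrightarrow> q (t *\<^sub>R x) \<le> t * q x" if "q \<in> C" for q x y t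
        using that CA unfolding A_def sublinear_def by blast+
      have "sublinear u"
        unfolding sublinear_def
      proof (intro conjI allI impI)
        fix x y
        have *: "u (x + y) \<le> q x + q' y" if q: "q \<in> C" "q' \<in> C" for q q'
        proof -
          from chain[OF q] obtain r where r: "r \<in> C" "r x \<le> q x" "r y \<le> q' y"
            using q unfolding P_def by blast
          then show ?thesis using ule[OF r(1), of "x + y"] sub(1)[OF r(1), of x y] by simp
        qed
        have "u (x + y) - q' y \<le> u x" if "q' \<in> C" for q'
          unfolding u_def[of x] using *[OF _ that] False
          by (intro cINF_greatest) (auto simp: algebra_simps)
        then have "u (x + y) - u x \<le> q' y" if "q' \<in> C" for q'
          using that by (simp add: algebra_simps)
        then have "u (x + y) - u x \<le> u y"
          unfolding u_def[of y] using False by (intro cINF_greatest) auto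
        then show "u (x + y) \<le> u x + u y" by simp
      next
        fix t :: real and x assume t: "0 \<le> t"
        show "u (t *\<^sub>R x) \<le> t * u x"
        proof (cases "t = 0")
          case True
          obtain q where q: "q \<in> C" using False by blast
          show ?thesis using ule[OF q, of 0] sub(2)[OF q, of 0 x] True by simp
        next
          case tn: False
          with t have t: "0 < t" by simp
          have "inverse t * u (t *\<^sub>R x) \<le> u x"
            unfolding u_def[of x]
          proof (rule cINF_greatest)
            fix q assume q: "q \<in> C"
            have "u (t *\<^sub>R x) \<le> t * q x"
              using ule[OF q, of "t *\<^sub>R x"] sub(2)[OF q, of t x] t by simp
            then show "inverse t * u (t *\<^sub>R x) \<le> q x" using t by (simp add: field_simps)
          qed (rule False)
          then show ?thesis using t by (simp add: field_simps)
        qed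
      qed
      moreover have "u x \<le> p x" for x
      proof -
        obtain q where q: "q \<in> C" using False by blast
        then have "q x \<le> p x" using CA by (auto simp: A_def)
        with ule[OF q, of x] show ?thesis by simp
      qed
      ultimately show ?thesis using ule by (auto simp: A_def P_def)
    qed
  qed
  then obtain m where m: "m \<in> A" and min: "\<And>a. a \<in> A \<Longrightarrow> P m a \<Longrightarrow> a = m" by blast
  have "q = m" if q: "sublinear q" "\<forall>x. q x \<le> m x" for q
  proof (rule min)
    have "q x \<le> p x" for x
      using q(2) m order_trans[of "q x" "m x" "p x"] by (auto simp: A_def)
    then show "q \<in> A" using q by (auto simp: A_def)
    show "P m q" using q by (simp add: P_def)
  qed
  then show ?thesis using m by (auto simp: A_def)
qed

text \<open>The minimal functional is taken below the descent of the norm at \<open>y\<close>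
  instead of the norm itself. With parameter 1 the descent is at most \<open>- norm y\<close> at
  \<open>- y\<close>, so an odd functional below it is at least \<open>norm y\<close> at
  \<open>y\<close>.\<close>

lemma norming_functional:
  fixes y :: "'a::real_normed_vector"
  shows "\<exists>\<phi> :: 'a \<Rightarrow>\<^sub>L real. norm \<phi> \<le> 1 \<and> norm y \<le> blinfun_apply \<phi> y"
proof -
  have n: "sublinear (norm :: 'a \<Rightarrow> real)"
    by (simp add: sublinear_def norm_triangle_ineq)
  let ?p = "sublinear_descent norm y"
  obtain m where m: "sublinear m" "\<And>x. m x \<le> ?p x"
    and min: "\<And>q. sublinear q \<Longrightarrow> (\<And>x. q x \<le> m x) \<Longrightarrow> q = m"
    using sublinear_minimal_exists[OF sublinear_sublinear_descent[OF n, of y]] by blast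
  have neg: "m (- z) = - m z" for z
  proof -
    have le: "sublinear_descent m z x \<le> m (x + t *\<^sub>R z) - t * m z" if "0 \<le> t" for x t
      using that by (rule sublinear_descent_le[OF m(1)])
    have "sublinear_descent m z = m"
      by (rule min[OF sublinear_sublinear_descent[OF m(1)]]) (use le[of 0] in simp)
    with le[of 1 "- z"] sublinear_lower(1)[OF m(1)] have "m (- z) \<le> - m z" by simp
    with sublinear_lower(2)[OF m(1), of z] show ?thesis by simp
  qed
  have le_norm: "m x \<le> norm x" for x
    using m(2)[of x] sublinear_descent_le[OF n, of 0 y x] by simp
  have sub: "m (a + b) \<le> m a + m b" "0 \<le> t \<Longrightarrow> m (t *\<^sub>R a) \<le> t * m a" for a b t
    using m(1) unfolding sublinear_def by blast+
  have add: "m (a + b) = m a + m b" for a b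
  proof (rule antisym[OF sub(1)])
    show "m a + m b \<le> m (a + b)"
      using sub(1)[of "a + b" "- b"] neg[of b] by simp
  qed
  have scale_pos: "m (t *\<^sub>R a) = t * m a" if "0 \<le> t" for t a
  proof (rule antisym[OF sub(2)[OF that]])
    show "t * m a \<le> m (t *\<^sub>R a)"
      using sub(2)[OF that, of "- a"] neg[of a] neg[of "t *\<^sub>R a"] by simp
  qed
  have lin: "bounded_linear m"
  proof (rule bounded_linear_intro[of _ 1])
    fix t a
    show "m (t *\<^sub>R a) = t *\<^sub>R m a"
      using scale_pos[of t a] scale_pos[of "- t" a] neg[of "t *\<^sub>R a"] by (cases "0 \<le> t") auto
    show "norm (m a) \<le> norm a * 1"
      using le_norm[of a] le_norm[of "- a"] neg[of a] by simp
  qed (rule add)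
  note app = bounded_linear_Blinfun_apply[OF lin]
  have "norm (Blinfun m) \<le> 1"
    by (rule norm_blinfun_bound) (use le_norm le_norm[of "- x" for x] neg in \<open>auto simp: app abs_le_iff\<close>)
  moreover have "m (- y) \<le> - norm y"
    using m(2)[of "- y"] sublinear_descent_le[OF n, of 1 y "- y"] by simp
  ultimately show ?thesis
    using neg[of y] by (intro exI[of _ "Blinfun m"]) (simp add: app)
qed

section \<open>Uniform boundedness\<close>

text \<open>Since \<open>f w\<close> is half the difference of the values at \<open>x + w\<close>
  and \<open>x - w\<close>, one of these values is at least as large as \<open>f w\<close> in
  modulus. Any factor below 1 would be correct here; 2/3 is chosen to exceed the later tail constant
  1/2.\<close>

lemma blinfun_large_near:
  fixes f :: "'a::real_normed_vector \<Rightarrow>\<^sub>L real"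
  assumes "0 < r"
  shows "\<exists>y. norm (y - x) \<le> r \<and> 2/3 * r * norm f \<le> \<bar>f y\<bar>"
proof (rule ccontr)
  assume neg: "\<not> ?thesis"
  then have small: "\<bar>f y\<bar> < 2/3 * r * norm f" if "norm (y - x) \<le> r" for y
    using that by force
  have "norm f \<le> 2/3 * norm f"
  proof (rule norm_blinfun_bound)
    fix z
    show "norm (f z) \<le> 2/3 * norm f * norm z"
    proof (cases "z = 0")
      case False
      define w where "w = (r / norm z) *\<^sub>R z"
      have "norm w = r" using False assms by (simp add: w_def)
      then have "\<bar>f (x + w)\<bar> < 2/3 * r * norm f" "\<bar>f (x - w)\<bar> < 2/3 * r * norm f"
        using small[of "x + w"] small[of "x - w"] by simp_all
      then have "\<bar>f w\<bar> < 2/3 * r * norm f"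
        unfolding blinfun.bilinear_simps by linarith
      moreover have "\<bar>f w\<bar> = r / norm z * \<bar>f z\<bar>"
        using assms by (simp add: w_def blinfun.scaleR_right abs_mult)
      ultimately have "r * \<bar>f z\<bar> \<le> r * (2/3 * norm f * norm z)"
        using False by (simp add: field_simps)
      then show ?thesis using assms by simp
    qed simp
  qed simp
  then have "norm f = 0" by simp
  with small[of x] assms show False by simp
qed

text \<open>Gliding hump: a point x with \<open>\<bar>f n x\<bar>\<close> unbounded is the limit of a sequence
  with steps \<open>3\<^sup>-\<^sup>n\<close>, each step keeping \<open>f n\<close> large.\<close>

lemma uniform_boundedness:
  fixes F :: "('a::banach \<Rightarrow>\<^sub>L real) set"
  assumes pw: "\<And>x. \<exists>C. \<forall>f\<in>F. \<bar>f x\<bar> \<le> C"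
  shows "\<exists>C. \<forall>f\<in>F. norm f \<le> C"
proof (rule ccontr)
  assume "\<not> ?thesis"
  then have "\<exists>f\<in>F. 4^n \<le> norm f" for n :: nat
    by (meson linear)
  then obtain f where f: "\<And>n. f n \<in> F" "\<And>n. 4^n \<le> norm (f n)" by metis
  have "\<exists>y. norm (y - x) \<le> (1/3)^n \<and> 2/3 * (1/3)^n * norm (f n) \<le> \<bar>f n y\<bar>" for n x
    by (rule blinfun_large_near) simp
  then have "\<forall>n x. \<exists>y. norm (y - x) \<le> (1/3)^n \<and> 2/3 * (1/3)^n * norm (f n) \<le> \<bar>f n y\<bar>"
    by blast
  then obtain nx where nx: "\<And>n x. norm (nx n x - x) \<le> (1/3)^n"
    "\<And>n x. 2/3 * (1/3)^n * norm (f n) \<le> \<bar>f n (nx n x)\<bar>"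
    unfolding choice_iff by blast
  define X where "X = rec_nat 0 (\<lambda>n x. nx n x)"
  have X: "X (Suc n) = nx n (X n)" for n by (simp add: X_def)
  define d where "d n = X (Suc n) - X n" for n
  have d: "norm (d n) \<le> (1/3)^n" for n
    using nx(1)[of n "X n"] by (simp add: d_def X)
  have sd: "summable (\<lambda>n. norm (d n))"
    by (rule summable_comparison_test'[of "\<lambda>n. (1/3)^n" 0]) (use d in \<open>auto intro: summable_geometric\<close>)
  then have sumd: "summable d" by (rule summable_norm_cancel)
  have Xs: "(\<Sum>i<n. d i) = X n" for n
    by (induction n) (auto simp: d_def X_def)
  define x where "x = suminf d"
  \<comment> \<open>The steps after \<open>X (Suc n)\<close> add up to half of
    \<open>(1/3)^n\<close>, less than the gain factor 2/3; the difference 1/6 survives in the limit,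
    and against \<open>norm (f n) \<ge> 4^n\<close> it leaves growth of order
    \<open>(4/3)^n\<close>.\<close>
  have tail: "norm (x - X (Suc n)) \<le> 1/2 * (1/3)^n" for n
  proof -
    have "x - X (Suc n) = (\<Sum>i. d (i + Suc n))"
      using suminf_split_initial_segment[OF sumd, of "Suc n"] Xs[of "Suc n"] by (simp add: x_def)
    also have "norm \<dots> \<le> (\<Sum>i. norm (d (i + Suc n)))"
      using sd by (intro summable_norm summable_ignore_initial_segment)
    also have "\<dots> \<le> (\<Sum>i. (1/3)^Suc n * (1/3)^i)"
    proof (rule suminf_le)
      show "norm (d (i + Suc n)) \<le> (1/3)^Suc n * (1/3)^i" for i
        using d[of "i + Suc n"] by (simp add: power_add mult_ac)
      show "summable (\<lambda>i. norm (d (i + Suc n)))"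
        using sd by (rule summable_ignore_initial_segment)
      show "summable (\<lambda>i. (1/3)^Suc n * (1/3::real)^i)"
        by (intro summable_mult summable_geometric) simp
    qed
    also have "\<dots> = (1/3)^Suc n * (\<Sum>i. (1/3::real)^i)"
      by (intro suminf_mult summable_geometric) simp
    also have "\<dots> = 1/2 * (1/3)^n"
      by (simp add: suminf_geometric)
    finally show ?thesis .
  qed
  have large: "1/6 * (4/3)^n \<le> \<bar>f n x\<bar>" for n
  proof -
    have "\<bar>f n (X (Suc n))\<bar> \<le> \<bar>f n x\<bar> + \<bar>f n (x - X (Suc n))\<bar>"
      by (simp add: blinfun.diff_right)
    moreover have "\<bar>f n (x - X (Suc n))\<bar> \<le> 1/2 * ((1/3)^n * norm (f n))"
      using norm_blinfun[of "f n" "x - X (Suc n)"] mult_left_mono[OF tail[of n], of "norm (f n)"]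
      by (simp add: mult.commute)
    moreover have "2/3 * ((1/3)^n * norm (f n)) \<le> \<bar>f n (X (Suc n))\<bar>"
      using nx(2)[of n "X n"] by (simp add: X mult.assoc)
    ultimately have "1/6 * ((1/3)^n * norm (f n)) \<le> \<bar>f n x\<bar>" by linarith
    moreover have "(1/3)^n * 4^n \<le> (1/3)^n * norm (f n)"
      using f(2) by (intro mult_left_mono) auto
    moreover have "(1/3)^n * 4^n = (4/3::real)^n"
      by (simp flip: power_mult_distrib)
    ultimately show ?thesis by simp
  qed
  obtain C where C: "\<And>n. \<bar>f n x\<bar> \<le> C" using pw[of x] f(1) by blast
  obtain n where "6 * C < (4/3)^n"
    using real_arch_pow[of "4/3" "6 * C"] by auto
  with large[of n] C[of n] show False by simp
qed

text \<open>Uniform boundedness is applied to the evaluations \<open>J n\<close> on the dual space,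
  which is complete; a norming functional carries the bound back to \<open>x n\<close>.\<close>

lemma weakly_null_bounded:
  fixes x :: "nat \<Rightarrow> 'a::real_normed_vector"
  assumes "weakly_null x"
  shows "\<exists>C. \<forall>n. norm (x n) \<le> C"
proof -
  define J where "J n = Blinfun (\<lambda>\<phi> :: 'a \<Rightarrow>\<^sub>L real. \<phi> (x n))" for n
  have J: "J n \<phi> = \<phi> (x n)" for n and \<phi> :: "'a \<Rightarrow>\<^sub>L real"
    unfolding J_def by (simp add: bounded_linear_Blinfun_apply blinfun.bounded_linear_left)
  have "\<exists>C. \<forall>f\<in>range J. norm f \<le> C"
  proof (rule uniform_boundedness)
    fix \<phi> :: "'a \<Rightarrow>\<^sub>L real"
    have "convergent (\<lambda>n. \<phi> (x n))"
      using assms by (auto simp: weakly_null_def convergent_def)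
    then obtain C where "\<And>n. norm (\<phi> (x n)) \<le> C"
      by (metis Bseq_def convergent_imp_Bseq)
    then show "\<exists>C. \<forall>f\<in>range J. \<bar>f \<phi>\<bar> \<le> C" by (auto simp: J)
  qed
  then obtain C where C: "\<And>n. norm (J n) \<le> C" by auto
  have "norm (x n) \<le> C" for n
  proof -
    obtain \<phi> :: "'a \<Rightarrow>\<^sub>L real" where \<phi>: "norm \<phi> \<le> 1" "norm (x n) \<le> blinfun_apply \<phi> (x n)"
      using norming_functional by blast
    have "\<phi> (x n) \<le> norm (J n) * norm \<phi>"
      using norm_blinfun[of "J n" \<phi>] by (simp add: J)
    also have "\<dots> \<le> C * 1"
      using C[of n] \<phi>(1) order_trans[OF norm_ge_zero C[of n]] by (intro mult_mono) auto
    finally show ?thesis using \<phi>(2) by simp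
  qed
  then show ?thesis by blast
qed


section \<open>Disjoint sequences below a weakly null sequence\<close>

text \<open>Schur's gliding hump with 0/1 weights. Indices are chosen so sparsely that in the column
  of a chosen index the rows up to the previous one and the rows from the next one on contribute
  less than \<open>\<delta>/4\<close> each. The subsum over the chosen indices then stays above
  \<open>\<delta>/2\<close> along these columns.\<close>

lemma diagonal_tendsto_zero:
  fixes a :: "nat \<Rightarrow> nat \<Rightarrow> real"
  assumes sm: "\<And>n. summable (\<lambda>k. \<bar>a k n\<bar>)"
    and lim: "\<And>K. (\<lambda>n. \<Sum>k. if k \<in> K then a k n else 0) \<longlonglongrightarrow> 0"
  shows "(\<lambda>n. a n n) \<longlonglongrightarrow> 0"
proof (rule ccontr)
  assume "\<not> ?thesis"
  then obtain \<delta> where \<delta>: "0 < \<delta>" and freq: "\<And>N. \<exists>n\<ge>N. \<delta> \<le> \<bar>a n n\<bar>"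
    unfolding LIMSEQ_def by (auto simp: not_less)
  have row: "(\<lambda>n. a k n) \<longlonglongrightarrow> 0" for k
  proof -
    have "(\<Sum>i. if i \<in> {k} then a i n else 0) = a k n" for n
      using suminf_finite[of "{k}" "\<lambda>i. if i \<in> {k} then a i n else 0"] by simp
    then show ?thesis using lim[of "{k}"] by simp
  qed
  have "\<exists>n>N. \<delta> \<le> \<bar>a n n\<bar> \<and> (\<Sum>k\<le>N. \<bar>a k n\<bar>) < \<delta>/4 \<and> (\<Sum>k. \<bar>a (k + n) N\<bar>) < \<delta>/4" for N
  proof -
    have "(\<lambda>n. \<Sum>k\<le>N. \<bar>a k n\<bar>) \<longlonglongrightarrow> (\<Sum>k\<le>N. \<bar>0\<bar>)"
      by (intro tendsto_sum tendsto_rabs row)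
    then have "\<forall>\<^sub>F n in sequentially. (\<Sum>k\<le>N. \<bar>a k n\<bar>) < \<delta>/4"
      using \<delta> by (intro order_tendstoD(2)[of _ 0]) auto
    moreover have "(\<lambda>n. \<Sum>k. \<bar>a (k + n) N\<bar>) \<longlonglongrightarrow> 0"
      using suminf_exist_split2[OF sm[of N]] by simp
    then have "\<forall>\<^sub>F n in sequentially. (\<Sum>k. \<bar>a (k + n) N\<bar>) < \<delta>/4"
      using \<delta> by (intro order_tendstoD(2)[of _ 0]) auto
    moreover have "\<forall>\<^sub>F n in sequentially. N < n"
      by (rule eventually_gt_at_top)
    ultimately have "\<forall>\<^sub>F n in sequentially. (\<Sum>k\<le>N. \<bar>a k n\<bar>) < \<delta>/4 \<and>
        (\<Sum>k. \<bar>a (k + n) N\<bar>) < \<delta>/4 \<and> N < n"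
      by eventually_elim auto
    then obtain M where "\<And>n. n \<ge> M \<Longrightarrow> (\<Sum>k\<le>N. \<bar>a k n\<bar>) < \<delta>/4 \<and>
        (\<Sum>k. \<bar>a (k + n) N\<bar>) < \<delta>/4 \<and> N < n"
      unfolding eventually_sequentially by blast
    with freq[of M] show ?thesis by blast
  qed
  then obtain nx where nx: "\<And>N. N < nx N" "\<And>N. \<delta> \<le> \<bar>a (nx N) (nx N)\<bar>"
    "\<And>N. (\<Sum>k\<le>N. \<bar>a k (nx N)\<bar>) < \<delta>/4" "\<And>N. (\<Sum>k. \<bar>a (k + nx N) N\<bar>) < \<delta>/4"
    by metis
  define s where "s j = (nx ^^ j) 0" for j
  have s: "s (Suc j) = nx (s j)" for j by (simp add: s_def)
  have mono: "strict_mono s"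
    by (simp add: strict_mono_Suc_iff s nx)
  define K where "K = range s"
  \<comment> \<open>The columns start at \<open>s (Suc j)\<close> because \<open>s 0 = 0\<close> is
    not produced by \<open>nx\<close> and its diagonal entry may be small. As \<open>K\<close> has
    no element strictly between consecutive values of \<open>s\<close>, the subsum consists of a
    head, one diagonal entry and a tail.\<close>
  have big: "\<delta>/2 \<le> \<bar>\<Sum>k. if k \<in> K then a k (s (Suc j)) else 0\<bar>" for j
  proof -
    define n where "n = s (Suc j)"
    define m where "m = s (Suc (Suc j))"
    define b where "b k = (if k \<in> K then a k n else 0)" for k
    have bs: "summable (\<lambda>k. \<bar>b k\<bar>)"
      by (rule summable_comparison_test'[OF sm[of n], of 0]) (auto simp: b_def)
    have nm: "s j < n" "n < m" "m = nx n" "n = nx (s j)"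
      using nx by (auto simp: n_def m_def s)
    have "suminf b = (\<Sum>k. b (k + m)) + (\<Sum>k<m. b k)"
      using bs by (intro suminf_split_initial_segment) (auto intro: summable_rabs_cancel)
    moreover have "(\<Sum>k<m. b k) = (\<Sum>k\<in>insert n {..s j}. b k)"
    proof (rule sum.mono_neutral_right)
      show "\<forall>k\<in>{..<m} - insert n {..s j}. b k = 0"
      proof
        fix k assume k: "k \<in> {..<m} - insert n {..s j}"
        have "k \<notin> K"
        proof
          assume "k \<in> K"
          then obtain i where i: "k = s i" by (auto simp: K_def)
          have "i < Suc (Suc j)" "j < i" and "s i \<noteq> s (Suc j)"
            using k i mono by (auto simp: m_def n_def strict_mono_less strict_mono_less_eq not_le)
          then show False by (cases "i = Suc j") auto
        qed
        then show "b k = 0" by (simp add: b_def)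
      qed
    qed (use nm in auto)
    moreover have "(\<Sum>k\<in>insert n {..s j}. b k) = b n + (\<Sum>k\<le>s j. b k)"
      using nm by (subst sum.insert) auto
    moreover have "b n = a n n" by (simp add: b_def K_def n_def)
    moreover have "\<bar>\<Sum>k\<le>s j. b k\<bar> < \<delta>/4"
    proof -
      have "\<bar>\<Sum>k\<le>s j. b k\<bar> \<le> (\<Sum>k\<le>s j. \<bar>a k n\<bar>)"
        by (rule order_trans[OF sum_abs sum_mono]) (simp add: b_def)
      then show ?thesis using nx(3)[of "s j"] nm(4) by simp
    qed
    moreover have "\<bar>\<Sum>k. b (k + m)\<bar> < \<delta>/4"
    proof -
      have sb: "summable (\<lambda>k. \<bar>b (k + m)\<bar>)"
        by (rule summable_ignore_initial_segment[OF bs])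
      have "\<bar>\<Sum>k. b (k + m)\<bar> \<le> (\<Sum>k. \<bar>b (k + m)\<bar>)"
        by (rule summable_rabs[OF sb])
      also have "\<dots> \<le> (\<Sum>k. \<bar>a (k + m) n\<bar>)"
        by (rule suminf_le[OF _ sb summable_ignore_initial_segment[OF sm]]) (simp add: b_def)
      finally show ?thesis using nx(4)[of n] nm(3) by simp
    qed
    moreover have "\<delta> \<le> \<bar>a n n\<bar>" using nx(2) nm(4) by simp
    ultimately have "\<delta>/2 \<le> \<bar>suminf b\<bar>" by linarith
    then show ?thesis unfolding b_def n_def .
  qed
  have "(\<lambda>j. \<Sum>k. if k \<in> K then a k (s (Suc j)) else 0) \<longlonglongrightarrow> 0"
    using LIMSEQ_subseq_LIMSEQ[OF lim[of K], of "\<lambda>j. s (Suc j)"] mono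
    by (simp add: o_def strict_mono_Suc_iff)
  then have "\<forall>\<^sub>F j in sequentially. \<bar>\<Sum>k. if k \<in> K then a k (s (Suc j)) else 0\<bar> < \<delta>/2"
    using \<delta> by (intro order_tendstoD(2)[of _ 0]) (auto intro: tendsto_rabs_zero)
  then obtain j where "\<bar>\<Sum>k. if k \<in> K then a k (s (Suc j)) else 0\<bar> < \<delta>/2"
    by (auto simp: eventually_sequentially)
  with big[of j] show False by simp
qed

text \<open>The functional \<open>\<psi>\<close> is the component of \<open>\<phi>\<close> on the
  band generated by \<open>y\<close>. A band projection need not exist in the space, but the real
  numbers \<open>\<phi> (inf z (k y))\<close> increase and are bounded by \<open>\<phi> z\<close>.
  Superadditivity of the limit costs a doubling of \<open>k\<close>.\<close>

lemma band_component_exists: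
  fixes \<phi> :: "'a::banach_lattice \<Rightarrow>\<^sub>L real"
  assumes pos: "\<And>z. 0 \<le> z \<Longrightarrow> 0 \<le> \<phi> z" and y: "0 \<le> y"
  shows "\<exists>\<psi> :: 'a \<Rightarrow>\<^sub>L real. \<forall>z\<ge>0. incseq (\<lambda>k. \<phi> (inf z (real k *\<^sub>R y))) \<and>
    (\<lambda>k. \<phi> (inf z (real k *\<^sub>R y))) \<longlonglongrightarrow> \<psi> z"
proof -
  define c where "c z k = \<phi> (inf z (real k *\<^sub>R y))" for z k
  have mono: "\<phi> u \<le> \<phi> v" if "u \<le> v" for u v
    using pos that by (rule blinfun_pos_mono)
  have ky: "0 \<le> real k *\<^sub>R y" for k using y by (intro scaleR_nonneg_nonneg) auto
  have inc: "incseq (c z)" for z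
    unfolding c_def using y
    by (intro incseq_SucI mono inf_mono order_refl scaleR_right_mono) auto
  define q where "q z = (SUP k. c z k)" for z
  have lim: "c z \<longlonglongrightarrow> q z" for z
    unfolding q_def
    by (rule LIMSEQ_incseq_SUP[OF _ inc]) (auto simp: c_def intro!: bdd_aboveI[of _ "\<phi> z"] mono)
  have "q (u + v) = q u + q v" if uv: "0 \<le> u" "0 \<le> v" for u v
  proof (rule antisym)
    show "q (u + v) \<le> q u + q v"
    proof (rule LIMSEQ_le[OF lim tendsto_add[OF lim lim]])
      have "c (u + v) k \<le> c u k + c v k" for k
      proof -
        have "inf (u + v) (real k *\<^sub>R y) \<le> inf u (real k *\<^sub>R y) + inf v (real k *\<^sub>R y)"
          using inf_add_le[OF uv ky[of k]] by (simp add: inf_commute)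
        from mono[OF this] show ?thesis by (simp add: c_def blinfun.add_right)
      qed
      then show "\<exists>N. \<forall>n\<ge>N. c (u + v) n \<le> c u n + c v n" by blast
    qed
    show "q u + q v \<le> q (u + v)"
    proof (rule LIMSEQ_le_const2[OF tendsto_add[OF lim lim]])
      have "c u k + c v k \<le> q (u + v)" for k
      proof -
        have "inf u (real k *\<^sub>R y) + inf v (real k *\<^sub>R y) \<le> inf (u + v) (real (k + k) *\<^sub>R y)"
          using add_mono[of "inf u (real k *\<^sub>R y)" "real k *\<^sub>R y" "inf v (real k *\<^sub>R y)" "real k *\<^sub>R y"]
          by (auto intro!: add_mono simp flip: scaleR_left_distrib)
        from mono[OF this] have "c u k + c v k \<le> c (u + v) (k + k)"
          by (simp add: c_def blinfun.add_right)
        also have "\<dots> \<le> q (u + v)" by (rule incseq_le[OF inc lim])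
        finally show ?thesis .
      qed
      then show "\<exists>N. \<forall>n\<ge>N. c u n + c v n \<le> q (u + v)" by blast
    qed
  qed
  moreover have "0 \<le> q u" if "0 \<le> u" for u
    using incseq_le[OF inc lim, of u 0] that by (simp add: c_def inf_absorb2)
  ultimately obtain \<psi> :: "'a \<Rightarrow>\<^sub>L real" where \<psi>: "\<And>x. 0 \<le> x \<Longrightarrow> \<psi> x = q x"
    using additive_extend by blast
  have "\<forall>z\<ge>0. incseq (c z) \<and> c z \<longlonglongrightarrow> \<psi> z"
    using \<psi> inc lim by simp
  then show ?thesis unfolding c_def by blast
qed

text \<open>The sum of two disjoint positive elements is their supremum. The auxiliary claim lets
  the number of summands vary independently of the term \<open>a k\<close>, so that it can be proved
  by induction.\<close>

lemma disjoint_sum_le: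
  fixes a :: "nat \<Rightarrow> 'a::lattice_ab_group_add"
  assumes "\<And>i. 0 \<le> a i" "\<And>i. a i \<le> z" "\<And>i j. i \<noteq> j \<Longrightarrow> inf (a i) (a j) = 0" "0 \<le> z"
  shows "(\<Sum>i<n. a i) \<le> z"
proof (induction n)
  case (Suc n)
  have "inf (a k) (\<Sum>i<m. a i) = 0" if "m \<le> k" for m k
    using that
  proof (induction m)
    case 0
    then show ?case using assms by (simp add: inf_absorb2)
  next
    case (Suc m)
    have "inf (a k) ((\<Sum>i<m. a i) + a m) \<le> inf (a k) (\<Sum>i<m. a i) + inf (a k) (a m)"
      using assms by (intro inf_add_le sum_nonneg) auto
    also have "\<dots> = 0" using Suc assms by simp
    finally show ?case
      using assms by (intro order.antisym) (auto intro!: sum_nonneg add_nonneg_nonneg)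
  qed
  then have "a n + (\<Sum>i<n. a i) = sup (a n) (\<Sum>i<n. a i)"
    using add_eq_inf_sup[of "a n" "\<Sum>i<n. a i"] by simp
  also have "\<dots> \<le> z" using Suc assms by simp
  finally show ?case by (simp add: add.commute)
qed (use assms in simp)

text \<open>The components \<open>\<psi> n\<close> of a positive functional \<open>\<phi>\<close> on the bands generated by the disjoint
  \<open>u n\<close> satisfy \<open>\<Sum>n. \<psi> n \<le> \<phi>\<close> and \<open>\<phi> (u n) \<le> \<psi> n (x n)\<close>, so the Schur property of the space of
  summable sequences applies.\<close>

lemma disjoint_below_weakly_null:
  fixes x u :: "nat \<Rightarrow> 'a::banach_lattice"
  assumes x: "weakly_null x" and u: "\<And>n. 0 \<le> u n" "\<And>n. u n \<le> pprt (x n)"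
    and disj: "\<And>n m. n \<noteq> m \<Longrightarrow> inf (u n) (u m) = 0"
  shows "weakly_null u"
proof (rule weakly_null_positiveI)
  fix \<phi> :: "'a \<Rightarrow>\<^sub>L real" assume pos: "\<And>z. 0 \<le> z \<Longrightarrow> 0 \<le> \<phi> z"
  have mono: "\<phi> u \<le> \<phi> v" if "u \<le> v" for u v
    using pos that by (rule blinfun_pos_mono)
  have "\<forall>n. \<exists>\<psi> :: 'a \<Rightarrow>\<^sub>L real. \<forall>z\<ge>0. incseq (\<lambda>k. \<phi> (inf z (real k *\<^sub>R u n))) \<and>
    (\<lambda>k. \<phi> (inf z (real k *\<^sub>R u n))) \<longlonglongrightarrow> \<psi> z"
    using band_component_exists[OF pos u(1)] by blast
  then obtain \<psi> :: "nat \<Rightarrow> ('a \<Rightarrow>\<^sub>L real)" where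
    \<psi>: "\<forall>n. \<forall>z\<ge>0. incseq (\<lambda>k. \<phi> (inf z (real k *\<^sub>R u n))) \<and>
      (\<lambda>k. \<phi> (inf z (real k *\<^sub>R u n))) \<longlonglongrightarrow> \<psi> n z"
    unfolding choice_iff by blast
  have ku: "0 \<le> real k *\<^sub>R u n" for k n using u by (intro scaleR_nonneg_nonneg) auto
  have \<psi>ge: "\<phi> (inf z (real k *\<^sub>R u n)) \<le> \<psi> n z" if "0 \<le> z" for z k n
    using \<psi> that incseq_le by blast
  have \<psi>pos: "0 \<le> \<psi> n z" if "0 \<le> z" for n z
    using \<psi>ge[OF that, of 0 n] that by (simp add: inf_absorb2)
  have part: "(\<Sum>n<N. \<psi> n z) \<le> \<phi> z" if z: "0 \<le> z" for N z
  proof (rule LIMSEQ_le_const2)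
    show "(\<lambda>k. \<Sum>n<N. \<phi> (inf z (real k *\<^sub>R u n))) \<longlonglongrightarrow> (\<Sum>n<N. \<psi> n z)"
      using \<psi> z by (intro tendsto_sum) blast
    have "(\<Sum>n<N. \<phi> (inf z (real k *\<^sub>R u n))) \<le> \<phi> z" for k
    proof -
      have "(\<Sum>n<N. inf z (real k *\<^sub>R u n)) \<le> z"
      proof (rule disjoint_sum_le)
        fix i j :: nat assume "i \<noteq> j"
        then have "inf (real k *\<^sub>R u i) (real k *\<^sub>R u j) = 0"
          using u by (metis disj disjoint_scaleR inf_commute ku of_nat_0_le_iff)
        then show "inf (inf z (real k *\<^sub>R u i)) (inf z (real k *\<^sub>R u j)) = 0"
          using z ku by (auto intro: disjoint_mono)
      qed (use z ku in auto)
      from mono[OF this] show ?thesis by (simp add: blinfun.sum_right)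
    qed
    then show "\<exists>M. \<forall>k\<ge>M. (\<Sum>n<N. \<phi> (inf z (real k *\<^sub>R u n))) \<le> \<phi> z" by blast
  qed
  have sm: "summable (\<lambda>n. \<psi> n z)" if "0 \<le> z" for z
    using \<psi>pos[OF that] part[OF that] by (intro summableI_nonneg_bounded) auto
  have split: "\<psi> n z = \<psi> n (pprt z) - \<psi> n (pprt (- z))" for n z
    by (simp only: pprt_diff_pprt_uminus flip: blinfun.diff_right)
  have "(\<lambda>n. \<psi> n (x n)) \<longlonglongrightarrow> 0"
  proof (rule diagonal_tendsto_zero[of "\<lambda>k n. \<psi> k (x n)"])
    show "summable (\<lambda>k. \<bar>\<psi> k (x n)\<bar>)" for n
    proof (rule summable_comparison_test'[where N = 0])
      show "summable (\<lambda>k. \<psi> k (pprt (x n)) + \<psi> k (pprt (- x n)))"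
        by (intro summable_add sm) auto
      show "norm \<bar>\<psi> k (x n)\<bar> \<le> \<psi> k (pprt (x n)) + \<psi> k (pprt (- x n))" for k
        using split[of k "x n"] \<psi>pos[of "pprt (x n)" k] \<psi>pos[of "pprt (- x n)" k] by simp
    qed
    fix K :: "nat set"
    \<comment> \<open>Each subsum of the components is again a positive additive map on the cone,
      hence a bounded functional that may be tested against the weakly null
      \<open>x\<close>.\<close>
    define q where "q z = (\<Sum>k. if k \<in> K then \<psi> k z else 0)" for z
    have smK: "summable (\<lambda>k. if k \<in> K then \<psi> k z else 0)" if "0 \<le> z" for z
      using \<psi>pos[OF that] by (intro summable_comparison_test'[OF sm[OF that], of 0]) auto
    have "q (v + w) = q v + q w" if "0 \<le> v" "0 \<le> w" for v w
      unfolding q_def suminf_add[OF smK[OF that(1)] smK[OF that(2)]]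
      by (intro suminf_cong) (auto simp: blinfun.add_right)
    moreover have "0 \<le> q v" if "0 \<le> v" for v
      unfolding q_def using smK[OF that] \<psi>pos[OF that] by (intro suminf_nonneg) auto
    ultimately obtain \<Phi> :: "'a \<Rightarrow>\<^sub>L real" where \<Phi>: "\<And>z. 0 \<le> z \<Longrightarrow> \<Phi> z = q z"
      using additive_extend by blast
    have "\<Phi> z = (\<Sum>k. if k \<in> K then \<psi> k z else 0)" for z
    proof -
      have "\<Phi> z = q (pprt z) - q (pprt (- z))"
        using \<Phi>[of "pprt z"] \<Phi>[of "pprt (- z)"]
        by (metis blinfun.diff_right pprt_diff_pprt_uminus zero_le_pprt)
      also have "\<dots> = (\<Sum>k. (if k \<in> K then \<psi> k (pprt z) else 0) - (if k \<in> K then \<psi> k (pprt (- z)) else 0))"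
        unfolding q_def by (intro suminf_diff smK) auto
      also have "\<dots> = (\<Sum>k. if k \<in> K then \<psi> k z else 0)"
        by (intro suminf_cong) (auto simp: split[of _ z])
      finally show ?thesis .
    qed
    then show "(\<lambda>n. \<Sum>k. if k \<in> K then \<psi> k (x n) else 0) \<longlonglongrightarrow> 0"
      using x[unfolded weakly_null_def, rule_format, of \<Phi>] by simp
  qed
  moreover have "\<phi> (u n) \<le> \<psi> n (x n)" for n
  proof -
    \<comment> \<open>As \<open>u n\<close> lies below the positive part of \<open>x n\<close>, its
      multiples are disjoint from the negative part, where \<open>\<psi> n\<close> therefore
      vanishes. This permits \<open>x n\<close> itself, and not only its positive part, in the
      estimate.\<close>
    have "inf (pprt (- x n)) (real k *\<^sub>R u n) = 0" for k
    proof (rule disjoint_scaleR)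
      show "inf (pprt (- x n)) (u n) = 0"
        by (rule disjoint_mono[OF inf_pprt_pprt_uminus[of "- x n"]]) (simp_all add: u)
    qed (use u in auto)
    then have "(\<lambda>k::nat. 0) \<longlonglongrightarrow> \<psi> n (pprt (- x n))"
      using \<psi>[rule_format, of "pprt (- x n)" n] by simp
    then have "\<psi> n (pprt (- x n)) = 0"
      using LIMSEQ_unique tendsto_const by blast
    moreover have "\<phi> (u n) \<le> \<psi> n (u n)"
      using \<psi>ge[OF u(1)[of n], of 1 n] by simp
    moreover have "\<psi> n (u n) \<le> \<psi> n (pprt (x n))"
      using \<psi>pos u(2)[of n] by (rule blinfun_pos_mono)
    ultimately show ?thesis using split[of n "x n"] by simp
  qed
  ultimately show "(\<lambda>n. \<phi> (u n)) \<longlonglongrightarrow> 0"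
    using pos[OF u(1)] by (intro tendsto_sandwich[of "\<lambda>_. 0" "\<lambda>n. \<phi> (u n)" sequentially "\<lambda>n. \<psi> n (x n)"]) auto
qed


section \<open>Reduction to disjoint sequences\<close>

lemma weakly_null_subseq: "strict_mono s \<Longrightarrow> weakly_null x \<Longrightarrow> weakly_null (\<lambda>n. x (s n))"
  unfolding weakly_null_def using LIMSEQ_subseq_LIMSEQ by (fastforce simp: o_def)

lemma weakly_null_minus: "weakly_null x \<Longrightarrow> weakly_null (\<lambda>n. - x n)"
  by (rule weakly_null_bounded_linear[OF bounded_linear_minus[OF bounded_linear_ident]])

lemma weakly_null_tendsto:
  fixes L :: "'a::real_normed_vector \<Rightarrow> real"
  assumes "weakly_null x" "bounded_linear L"
  shows "(\<lambda>n. L (x n)) \<longlonglongrightarrow> 0"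
  using assms(1)[unfolded weakly_null_def, rule_format, of "Blinfun L"]
  by (simp add: bounded_linear_Blinfun_apply[OF assms(2)])

lemma tendsto_zero_subseqI:
  fixes f :: "nat \<Rightarrow> real"
  assumes "\<And>t :: nat \<Rightarrow> nat. strict_mono t \<Longrightarrow> \<exists>s. strict_mono s \<and> (\<lambda>n. f (t (s n))) \<longlonglongrightarrow> 0"
  shows "f \<longlonglongrightarrow> 0"
proof (rule ccontr)
  assume "\<not> ?thesis"
  then obtain \<delta> where \<delta>: "0 < \<delta>" and freq: "\<And>N. \<exists>n\<ge>N. \<delta> \<le> \<bar>f n\<bar>"
    unfolding LIMSEQ_def by (auto simp: not_less)
  have "infinite {n. \<delta> \<le> \<bar>f n\<bar>}"
    unfolding infinite_nat_iff_unbounded_le using freq by blast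
  then obtain t :: "nat \<Rightarrow> nat" where t: "strict_mono t" "\<And>n. \<delta> \<le> \<bar>f (t n)\<bar>"
    using infinite_enumerate by blast
  obtain s :: "nat \<Rightarrow> nat" where "(\<lambda>n. f (t (s n))) \<longlonglongrightarrow> 0"
    using assms[OF t(1)] by blast
  then have "\<forall>\<^sub>F n in sequentially. \<bar>f (t (s n))\<bar> < \<delta>"
    using \<delta> by (intro order_tendstoD(2)[of _ 0]) (auto intro: tendsto_rabs_zero)
  then obtain n where "\<bar>f (t (s n))\<bar> < \<delta>"
    by (auto simp: eventually_sequentially)
  with t(2)[of "s n"] show False by simp
qed

text \<open>The two differences are \<open>d\<close> and \<open>- c d\<close> for the same
  \<open>d\<close>, so up to a positive factor their positive parts are the positive and the
  negative part of \<open>d\<close>.\<close>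

lemma disjoint_pprt_scaled:
  fixes a b :: "'a::banach_lattice"
  assumes "0 < c"
  shows "inf (pprt (a - inverse c *\<^sub>R b)) (pprt (b - c *\<^sub>R a)) = 0"
proof -
  define d where "d = a - inverse c *\<^sub>R b"
  have "b - c *\<^sub>R a = - (c *\<^sub>R d)"
    using assms by (simp add: d_def scaleR_right_diff_distrib)
  then have "pprt (b - c *\<^sub>R a) = - nprt (c *\<^sub>R d)" by (simp only: pprt_neg)
  also have "\<dots> = c *\<^sub>R pprt (- d)"
    using scaleR_inf_distrib[OF assms, of d 0] by (simp only: pprt_neg nprt_def scaleR_minus_right scaleR_zero_right)
  finally show ?thesis
    using disjoint_scaleR[OF inf_pprt_pprt_uminus[of d]] assms by (simp add: d_def)
qed

text \<open>Along a subsequence chosen fast enough, subtracting from each term a large multiple of the sum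
  of its predecessors and a small multiple of a common upper bound \<open>w\<close> leaves disjoint positive parts.\<close>

lemma disjointification:
  fixes g :: "nat \<Rightarrow> 'a::banach_lattice" and C :: "'a \<Rightarrow> nat \<Rightarrow> real"
  assumes g: "weakly_null g" and C: "\<And>h. 0 \<le> h \<Longrightarrow> C h \<longlonglongrightarrow> 0"
  shows "\<exists>s u h w. strict_mono s \<and> disjoint_seq u \<and> weakly_null u \<and>
    (\<forall>n. 0 \<le> u n) \<and> (\<forall>n. 0 \<le> h n) \<and> 0 \<le> w \<and>
    (\<forall>n. pprt (g (s n)) - u n = inf (pprt (g (s n))) (h n + ((1/2)^n) *\<^sub>R w)) \<and>
    (\<forall>n. C (h n) (s n) < (1/2)^n)"
proof -
  \<comment> \<open>The weight is used at \<open>N = \<sigma> m\<close>, which is at least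
    \<open>m\<close>. Removing \<open>4^m\<close> times an earlier term from a later one calls for
    removing \<open>inverse (4^m)\<close> times the later from the earlier; for \<open>n < m\<close>
    this is at most \<open>2^Suc m / 4^m \<le> (1/2)^n\<close> times \<open>w\<close>.\<close>
  define H where "H N = (4^N) *\<^sub>R (\<Sum>i\<le>N. pprt (g i))" for N :: nat
  have H: "0 \<le> H N" for N
    unfolding H_def by (intro scaleR_nonneg_nonneg sum_nonneg) auto
  \<comment> \<open>The error \<open>C (H N)\<close> attached to the bound \<open>H N\<close> tends
    to 0, and \<open>H N\<close> is fixed before the next index is chosen, so that index can be
    taken far enough out.\<close>
  have "\<exists>n>N. C (H N) n < (1/2)^N" for N
  proof -
    have "\<forall>\<^sub>F n in sequentially. C (H N) n < (1/2)^N"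
      using C[OF H] by (intro order_tendstoD(2)) auto
    moreover have "\<forall>\<^sub>F n in sequentially. N < n" by (rule eventually_gt_at_top)
    ultimately have "\<forall>\<^sub>F n in sequentially. N < n \<and> C (H N) n < (1/2)^N"
      by eventually_elim auto
    then show ?thesis by (auto simp: eventually_sequentially)
  qed
  then obtain nx where nx: "\<And>N. N < nx N" "\<And>N. C (H N) (nx N) < (1/2)^N" by metis
  define \<sigma> where "\<sigma> j = (nx ^^ j) 0" for j
  have \<sigma>: "\<sigma> (Suc j) = nx (\<sigma> j)" for j by (simp add: \<sigma>_def)
  have mono: "strict_mono \<sigma>" by (simp add: strict_mono_Suc_iff \<sigma> nx)
  define X where "X k = pprt (g (\<sigma> k))" for k
  have Xpos: "0 \<le> X k" for k by (simp add: X_def)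
  obtain K where K: "\<And>n. norm (g n) \<le> K" using weakly_null_bounded[OF g] by blast
  have "norm (X k) \<le> K" for k
    unfolding X_def using norm_pprt_le K order_trans by blast
  with Xpos obtain w where w: "0 \<le> w" "\<And>k. X k \<le> (2^k) *\<^sub>R w"
    using weighted_suminf[of X K] by metis
  \<comment> \<open>The offset is deliberate: \<open>H (\<sigma> n)\<close> collects the terms up to
    index \<open>\<sigma> n\<close>, so the term treated is the next one, and the subsequence
    returned is \<open>\<sigma>\<close> shifted by one.\<close>
  define u where "u n = pprt (X (Suc n) - (H (\<sigma> n) + ((1/2)^n) *\<^sub>R w))" for n
  have disj: "inf (u n) (u m) = 0" if nm: "n < m" for n m
  proof (rule disjoint_mono)
    let ?a = "X (Suc n)" and ?b = "X (Suc m)"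
    show "inf (pprt (?a - inverse (4^m) *\<^sub>R ?b)) (pprt (?b - (4^m) *\<^sub>R ?a)) = 0"
      by (rule disjoint_pprt_scaled) simp
    have "inverse (4^m) *\<^sub>R ?b \<le> inverse (4^m) *\<^sub>R ((2^Suc m) *\<^sub>R w)"
      by (rule scaleR_left_mono[OF w(2)]) simp
    also have "\<dots> = (inverse (4^m) * 2^Suc m) *\<^sub>R w" by simp
    also have "\<dots> \<le> ((1/2)^n) *\<^sub>R w"
    proof (rule scaleR_right_mono[OF _ w(1)])
      have "(4::real)^m = 2^m * 2^m" by (simp flip: power_mult_distrib)
      moreover have "(2::real)^Suc n \<le> 2^m" using nm by (intro power_increasing) auto
      ultimately show "inverse (4^m) * 2^Suc m \<le> (1/2::real)^n"
        by (simp add: field_simps)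
    qed
    also have "\<dots> \<le> H (\<sigma> n) + ((1/2)^n) *\<^sub>R w" using H by simp
    finally show "u n \<le> pprt (?a - inverse (4^m) *\<^sub>R ?b)"
      unfolding u_def by (intro pprt_mono diff_left_mono)
    have "?a \<le> (\<Sum>i\<le>\<sigma> m. pprt (g i))"
    proof -
      have "\<sigma> (Suc n) \<le> \<sigma> m" using mono nm by (simp add: strict_mono_less_eq)
      then have "(\<Sum>i\<le>\<sigma> m. pprt (g i)) = ?a + (\<Sum>i\<in>{..\<sigma> m} - {\<sigma> (Suc n)}. pprt (g i))"
        unfolding X_def by (intro sum.remove) auto
      moreover have "0 \<le> (\<Sum>i\<in>{..\<sigma> m} - {\<sigma> (Suc n)}. pprt (g i))" by (rule sum_nonneg) simp
      ultimately show ?thesis by simp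
    qed
    then have "(4^m) *\<^sub>R ?a \<le> (4^m) *\<^sub>R (\<Sum>i\<le>\<sigma> m. pprt (g i))"
      by (rule scaleR_left_mono) simp
    also have "\<dots> \<le> H (\<sigma> m)"
      unfolding H_def using strict_mono_imp_increasing[OF mono, of m]
      by (intro scaleR_right_mono power_increasing sum_nonneg) auto
    also have "\<dots> \<le> H (\<sigma> m) + ((1/2)^m) *\<^sub>R w"
      using w(1) by (simp add: scaleR_nonneg_nonneg)
    finally show "u m \<le> pprt (?b - (4^m) *\<^sub>R ?a)"
      unfolding u_def by (intro pprt_mono diff_left_mono)
  qed (simp_all add: u_def)
  then have disj': "inf (u n) (u m) = 0" if "n \<noteq> m" for n m
    using that by (metis inf_commute linorder_neqE_nat)
  have upos: "0 \<le> u n" for n by (simp add: u_def)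
  have rest: "X (Suc n) - u n = inf (X (Suc n)) (H (\<sigma> n) + ((1/2)^n) *\<^sub>R w)" for n
    using diff_inf_eq_pprt[of "X (Suc n)" "H (\<sigma> n) + ((1/2)^n) *\<^sub>R w"] unfolding u_def
    by (metis add_diff_cancel_right' diff_add_cancel add_diff_cancel_left')
  have mono': "strict_mono (\<lambda>n. \<sigma> (Suc n))" using mono by (simp add: strict_mono_Suc_iff)
  have "u n \<le> X (Suc n)" for n
  proof -
    have "0 \<le> X (Suc n) - u n"
      unfolding rest using Xpos H w(1) by (auto intro!: add_nonneg_nonneg scaleR_nonneg_nonneg)
    then show ?thesis by simp
  qed
  then have "weakly_null u"
    unfolding X_def by (intro disjoint_below_weakly_null[OF weakly_null_subseq[OF mono' g]] upos disj')
  moreover have "disjoint_seq u"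
    unfolding disjoint_seq_def using disj' by (simp add: labs_of_nonneg[OF upos])
  moreover have "C (H (\<sigma> n)) (\<sigma> (Suc n)) < (1/2)^n" for n
  proof -
    have "(1/2::real)^\<sigma> n \<le> (1/2)^n"
      using strict_mono_imp_increasing[OF mono, of n] by (intro power_decreasing) auto
    from order_less_le_trans[OF nx(2)[of "\<sigma> n"] this] show ?thesis by (simp only: \<sigma>)
  qed
  ultimately show ?thesis
    using mono' upos H w(1) rest unfolding X_def
    by (intro exI[of _ "\<lambda>n. \<sigma> (Suc n)"] exI[of _ u] exI[of _ "\<lambda>n. H (\<sigma> n)"] exI[of _ w]) blast
qed

section \<open>Bilinear forms that vanish along disjoint sequences\<close>

text \<open>For order bounded functionals \<open>A n\<close> with moduli this is convergence of the
  moduli to 0 at each positive \<open>h\<close>. The majorant \<open>c\<close> avoids both moduli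
  and suprema over intervals.\<close>

definition null_on_intervals :: "(nat \<Rightarrow> 'a::banach_lattice \<Rightarrow> real) \<Rightarrow> bool" where
  "null_on_intervals A \<longleftrightarrow>
     (\<forall>h\<ge>0. \<exists>c. c \<longlonglongrightarrow> 0 \<and> (\<forall>n r. 0 \<le> r \<longrightarrow> r \<le> h \<longrightarrow> \<bar>A n r\<bar> \<le> c n))"

lemma null_on_intervals_subseq:
  assumes "null_on_intervals A" "strict_mono s"
  shows "null_on_intervals (\<lambda>n. A (s n))"
  unfolding null_on_intervals_def
proof (intro allI impI)
  fix h :: 'a assume "0 \<le> h"
  then obtain c where c: "c \<longlonglongrightarrow> 0" "\<forall>n r. 0 \<le> r \<longrightarrow> r \<le> h \<longrightarrow> \<bar>A n r\<bar> \<le> c n"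
    using assms(1) unfolding null_on_intervals_def by blast
  have "(\<lambda>n. c (s n)) \<longlonglongrightarrow> 0"
    using LIMSEQ_subseq_LIMSEQ[OF c(1) assms(2)] by (simp add: o_def)
  with c(2) show "\<exists>c. c \<longlonglongrightarrow> 0 \<and> (\<forall>n r. 0 \<le> r \<longrightarrow> r \<le> h \<longrightarrow> \<bar>A (s n) r\<bar> \<le> c n)"
    by blast
qed

text \<open>What \<open>u n\<close> omits lies below \<open>h n\<close> plus \<open>(1/2)^n\<close>
  times \<open>w\<close>, and Riesz decomposition separates the two bounds. The first piece is small
  by the choice of the subsequence, the second by rescaling it into the fixed interval below
  \<open>w\<close>.\<close>

lemma approximate_by_disjoint:
  fixes g :: "nat \<Rightarrow> 'a::banach_lattice"
  assumes g: "weakly_null g" and A: "null_on_intervals A" and lin: "\<And>n. linear (A n)"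
  shows "\<exists>s u. strict_mono s \<and> disjoint_seq u \<and> weakly_null u \<and> (\<forall>n. 0 \<le> u n) \<and>
    (\<lambda>n. A (s n) (pprt (g (s n)) - u n)) \<longlonglongrightarrow> 0"
proof -
  have "\<forall>h. \<exists>c. 0 \<le> h \<longrightarrow> c \<longlonglongrightarrow> 0 \<and> (\<forall>n r. 0 \<le> r \<longrightarrow> r \<le> h \<longrightarrow> \<bar>A n r\<bar> \<le> c n)"
    using A unfolding null_on_intervals_def by blast
  then obtain C where C': "\<forall>h. 0 \<le> h \<longrightarrow> C h \<longlonglongrightarrow> 0 \<and> (\<forall>n r. 0 \<le> r \<longrightarrow> r \<le> h \<longrightarrow> \<bar>A n r\<bar> \<le> C h n)"
    unfolding choice_iff by blast
  then have C: "\<And>h. 0 \<le> h \<Longrightarrow> C h \<longlonglongrightarrow> 0"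
    "\<And>h n r. 0 \<le> r \<Longrightarrow> r \<le> h \<Longrightarrow> \<bar>A n r\<bar> \<le> C h n"
    by (blast, meson order_trans)
  obtain s u h w where s: "strict_mono s" and u: "disjoint_seq u" "weakly_null u" "\<And>n. 0 \<le> u n"
    and h: "\<And>n. 0 \<le> h n" and w: "0 \<le> w"
    and rest: "\<And>n. pprt (g (s n)) - u n = inf (pprt (g (s n))) (h n + ((1/2)^n) *\<^sub>R w)"
    and Ch: "\<And>n. C (h n) (s n) < (1/2)^n"
    using disjointification[of g C, OF g C(1)] by blast
  have bound: "\<bar>A (s n) (pprt (g (s n)) - u n)\<bar> \<le> (1/2)^n + (1/2)^n * C w (s n)" for n
  proof -
    let ?r = "pprt (g (s n)) - u n"
    have w': "0 \<le> ((1/2)^n) *\<^sub>R w" using w by (intro scaleR_nonneg_nonneg) auto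
    have "0 \<le> ?r" "?r \<le> h n + ((1/2)^n) *\<^sub>R w"
      unfolding rest using h w' by auto
    then obtain a b where ab: "?r = a + b" "0 \<le> a" "a \<le> h n" "0 \<le> b" "b \<le> ((1/2)^n) *\<^sub>R w"
      using riesz_decomposition[OF h w'] by metis
    have "\<bar>A (s n) a\<bar> \<le> (1/2)^n"
      using C(2)[OF ab(2,3), of "s n"] Ch[of n] by simp
    moreover have "\<bar>A (s n) b\<bar> \<le> (1/2)^n * C w (s n)"
    proof -
      have "(2^n) *\<^sub>R b \<le> (2^n) *\<^sub>R (((1/2)^n) *\<^sub>R w)"
        using ab(5) by (rule scaleR_left_mono) simp
      also have "\<dots> = w" by (simp flip: power_mult_distrib)
      finally have "\<bar>A (s n) ((2^n) *\<^sub>R b)\<bar> \<le> C w (s n)"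
        using ab(4) by (intro C(2) scaleR_nonneg_nonneg) auto
      then show ?thesis
        by (simp add: linear_cmul[OF lin] abs_mult power_divide field_simps)
    qed
    ultimately show ?thesis
      unfolding ab(1) by (simp add: linear_add[OF lin])
  qed
  have "(\<lambda>n. (1/2)^n + (1/2)^n * C w (s n)) \<longlonglongrightarrow> 0 + 0 * 0"
    using LIMSEQ_subseq_LIMSEQ[OF C(1)[OF w] s]
    by (intro tendsto_add tendsto_mult LIMSEQ_power_zero) (auto simp: o_def)
  then have "(\<lambda>n. (1/2)^n + (1/2)^n * C w (s n)) \<longlonglongrightarrow> 0"
    by (simp only: mult_zero_left add_0_left)
  moreover have "\<forall>\<^sub>F n in sequentially. norm (A (s n) (pprt (g (s n)) - u n))
      \<le> (1/2)^n + (1/2)^n * C w (s n)"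
    unfolding real_norm_def by (rule always_eventually) (rule allI, rule bound)
  ultimately have "(\<lambda>n. A (s n) (pprt (g (s n)) - u n)) \<longlonglongrightarrow> 0"
    by (rule Lim_null_comparison[rotated])
  then show ?thesis using s u by blast
qed

text \<open>Stated for an abstract bilinear form so that points and functionals can exchange roles.
  Smallness of \<open>B (x n)\<close> on intervals pays for replacing the second argument by
  positive disjoint \<open>u n\<close>; positivity of \<open>u n\<close> then activates
  \<open>pos\<close>, which pays for replacing the first.\<close>

lemma bilinear_null_from_disjoint:
  fixes B :: "'e::banach_lattice \<Rightarrow> 'g::banach_lattice \<Rightarrow> real"
  assumes lin1: "\<And>g. linear (\<lambda>x. B x g)" and lin2: "\<And>x. linear (B x)"
    and disj: "\<And>x g. disjoint_seq x \<Longrightarrow> weakly_null x \<Longrightarrow> disjoint_seq g \<Longrightarrow> weakly_null g \<Longrightarrow>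
        (\<lambda>n. B (x n) (g n)) \<longlonglongrightarrow> 0"
    and pos: "\<And>u. weakly_null u \<Longrightarrow> (\<And>n. 0 \<le> u n) \<Longrightarrow> null_on_intervals (\<lambda>n r. B r (u n))"
    and x: "weakly_null x" "null_on_intervals (\<lambda>n. B (x n))" and g: "weakly_null g"
  shows "(\<lambda>n. B (x n) (g n)) \<longlonglongrightarrow> 0"
proof -
  have step1: "(\<lambda>n. B (pprt (y n)) (u n)) \<longlonglongrightarrow> 0"
    if y: "weakly_null y" and u: "disjoint_seq u" "weakly_null u" "\<And>n. 0 \<le> u n" for y u
  proof (rule tendsto_zero_subseqI)
    fix t :: "nat \<Rightarrow> nat" assume t: "strict_mono t"
    have "null_on_intervals (\<lambda>n r. B r (u (t n)))"
      using pos[OF weakly_null_subseq[OF t u(2)]] u(3) by blast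
    then obtain s v where s: "strict_mono s" and v: "disjoint_seq v" "weakly_null v"
      and lim: "(\<lambda>n. B (pprt (y (t (s n))) - v n) (u (t (s n)))) \<longlonglongrightarrow> 0"
      using approximate_by_disjoint[OF weakly_null_subseq[OF t y], of "\<lambda>n r. B r (u (t n))"] lin1
      by blast
    have ts: "strict_mono (\<lambda>n. t (s n))" using t s by (simp add: strict_mono_def)
    have "disjoint_seq (\<lambda>n. u (t (s n)))"
      using u(1) ts unfolding disjoint_seq_def by (metis strict_mono_eq)
    then have "(\<lambda>n. B (v n) (u (t (s n)))) \<longlonglongrightarrow> 0"
      by (intro disj v weakly_null_subseq[OF ts] u)
    from tendsto_add[OF lim this] have "(\<lambda>n. B (pprt (y (t (s n)))) (u (t (s n)))) \<longlonglongrightarrow> 0"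
      by (simp add: linear_diff[OF lin1])
    then show "\<exists>s. strict_mono s \<and> (\<lambda>n. B (pprt (y (t (s n)))) (u (t (s n)))) \<longlonglongrightarrow> 0"
      using s by blast
  qed
  have step2: "(\<lambda>n. B (x n) (pprt (g n))) \<longlonglongrightarrow> 0" if g: "weakly_null g" for g
  proof (rule tendsto_zero_subseqI)
    fix t :: "nat \<Rightarrow> nat" assume t: "strict_mono t"
    obtain s u where s: "strict_mono s" and u: "disjoint_seq u" "weakly_null u" "\<And>n. 0 \<le> u n"
      and lim: "(\<lambda>n. B (x (t (s n))) (pprt (g (t (s n))) - u n)) \<longlonglongrightarrow> 0"
      using approximate_by_disjoint[OF weakly_null_subseq[OF t g]
          null_on_intervals_subseq[OF x(2) t] lin2] by blast
    have ts: "strict_mono (\<lambda>n. t (s n))" using t s by (simp add: strict_mono_def)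
    let ?y = "\<lambda>n. x (t (s n))"
    have y: "weakly_null ?y" by (rule weakly_null_subseq[OF ts x(1)])
    have "B (pprt z) v - B (pprt (- z)) v = B z v" for z v
      using linear_diff[OF lin1[of v], of "pprt z" "pprt (- z)"] by (simp only: pprt_diff_pprt_uminus)
    then have "(\<lambda>n. B (?y n) (u n)) \<longlonglongrightarrow> 0"
      using tendsto_diff[OF step1[OF y u] step1[OF weakly_null_minus[OF y] u]] by simp
    from tendsto_add[OF lim this] have "(\<lambda>n. B (?y n) (pprt (g (t (s n))))) \<longlonglongrightarrow> 0"
      by (simp add: linear_diff[OF lin2])
    then show "\<exists>s. strict_mono s \<and> (\<lambda>n. B (x (t (s n))) (pprt (g (t (s n))))) \<longlonglongrightarrow> 0"
      using s by blast
  qed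
  have "B z (pprt v) - B z (pprt (- v)) = B z v" for z v
    using linear_diff[OF lin2[of z], of "pprt v" "pprt (- v)"] by (simp only: pprt_diff_pprt_uminus)
  then show ?thesis
    using tendsto_diff[OF step2[OF g] step2[OF weakly_null_minus[OF g]]] by simp
qed


section \<open>Discrete Banach lattices with order continuous norm\<close>

lemma scaleR_le_zero_imp:
  fixes d :: "'a::banach_lattice"
  assumes "0 < d" "t *\<^sub>R d \<le> 0"
  shows "t \<le> 0"
proof (rule ccontr)
  assume "\<not> t \<le> 0"
  then have "inverse t *\<^sub>R (t *\<^sub>R d) \<le> inverse t *\<^sub>R 0"
    by (intro scaleR_left_mono[OF assms(2)]) simp
  with \<open>\<not> t \<le> 0\<close> have "d \<le> 0" by simp
  with assms(1) show False by simp
qed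

lemma greatest_multiple_exists:
  fixes d x :: "'a::banach_lattice"
  assumes d: "0 < d" and x: "0 \<le> x"
  shows "\<exists>c\<ge>0. c *\<^sub>R d \<le> x \<and> (\<forall>t. t *\<^sub>R d \<le> x \<longrightarrow> t \<le> c)"
proof -
  let ?S = "{t. t *\<^sub>R d \<le> x}"
  have nd: "0 < norm d" using d by auto
  have bound: "t \<le> norm x / norm d" if t: "t *\<^sub>R d \<le> x" for t
  proof (cases "0 \<le> t")
    case True
    then have "norm (t *\<^sub>R d) \<le> norm x"
      using d t by (intro norm_mono_nonneg scaleR_nonneg_nonneg) auto
    then show ?thesis using True nd by (simp add: field_simps)
  next
    case False
    moreover have "0 \<le> norm x / norm d" by simp
    ultimately show ?thesis by linarith
  qed
  then have bdd: "bdd_above ?S" by (intro bdd_aboveI[of _ "norm x / norm d"]) auto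
  have 0: "0 \<in> ?S" using x by simp
  have upper: "t \<le> Sup ?S" if "t *\<^sub>R d \<le> x" for t
    using that by (intro cSup_upper[OF _ bdd]) simp
  have "Sup ?S *\<^sub>R d \<le> x"
  proof (rule le_of_le_scaleR_add)
    fix e :: real assume "0 < e"
    moreover have "?S \<noteq> {}" using 0 by blast
    ultimately obtain t where t: "t *\<^sub>R d \<le> x" "Sup ?S - e < t"
      using less_cSupD[of ?S "Sup ?S - e"] by auto
    have "(Sup ?S - e) *\<^sub>R d \<le> t *\<^sub>R d"
      using t d by (intro scaleR_right_mono) auto
    with t(1) have "(Sup ?S - e) *\<^sub>R d \<le> x" by (rule order_trans[rotated])
    then show "Sup ?S *\<^sub>R d \<le> x + e *\<^sub>R d"
      by (simp add: scaleR_left_diff_distrib diff_le_eq)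
  qed
  with upper upper[of 0] x show ?thesis by (intro exI[of _ "Sup ?S"]) simp
qed

text \<open>Let \<open>t\<close> be the largest coefficient with \<open>t d\<close> below
  \<open>v\<close>. The positive and negative parts of \<open>v - (t + e) d\<close> are disjoint
  and, after rescaling the latter by \<open>c\<close>, both lie below \<open>d\<close>, so one of
  them is 0. Maximality of \<open>t\<close> excludes the negative part.\<close>

lemma discrete_elem_interval:
  fixes d :: "'a::banach_lattice"
  assumes d: "discrete_elem d" and v: "0 \<le> v" "v \<le> d"
  shows "\<exists>t\<ge>0. v = t *\<^sub>R d"
proof -
  have d0: "0 < d" using d by (simp add: discrete_elem_def)
  obtain t where t: "0 \<le> t" "t *\<^sub>R d \<le> v" "\<And>r. r *\<^sub>R d \<le> v \<Longrightarrow> r \<le> t"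
    using greatest_multiple_exists[OF d0 v(1)] by blast
  have "v \<le> t *\<^sub>R d"
  proof (rule le_of_le_scaleR_add)
    fix e :: real assume e: "0 < e"
    define a where "a = pprt (v - (t + e) *\<^sub>R d)"
    define b where "b = pprt (- (v - (t + e) *\<^sub>R d))"
    define c where "c = inverse (t + e)"
    have c: "0 < c" using t e by (simp add: c_def)
    have ted: "0 \<le> (t + e) *\<^sub>R d" using t e d0 by (intro scaleR_nonneg_nonneg) auto
    have ab: "inf a b = 0" unfolding a_def b_def by (rule inf_pprt_pprt_uminus)
    have "a \<le> v" unfolding a_def pprt_def using ted v by simp
    then have "a \<le> d" using v by simp
    have "b \<le> (t + e) *\<^sub>R d" unfolding b_def pprt_def using ted v by simp
    then have "c *\<^sub>R b \<le> c *\<^sub>R ((t + e) *\<^sub>R d)" using c by (intro scaleR_left_mono) auto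
    also have "\<dots> = d" using t e by (simp add: c_def)
    finally have "c *\<^sub>R b \<le> d" .
    moreover have "0 \<le> c *\<^sub>R b" using c by (intro scaleR_nonneg_nonneg) (auto simp: b_def)
    moreover have "inf a (c *\<^sub>R b) = 0"
      using ab c by (intro disjoint_scaleR) (auto simp: a_def b_def)
    ultimately have "a = 0 \<or> c *\<^sub>R b = 0"
      using d[unfolded discrete_elem_def, THEN conjunct2, rule_format, of a "c *\<^sub>R b"] \<open>a \<le> d\<close>
      by (simp add: a_def del: scaleR_eq_0_iff)
    moreover have "b \<noteq> 0"
    proof
      assume "b = 0"
      then have "- (v - (t + e) *\<^sub>R d) \<le> 0"
        unfolding b_def using le_pprt by metis
      then have "(t + e) *\<^sub>R d \<le> v" by simp
      with t(3) e show False by fastforce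
    qed
    ultimately have "a = 0" using c by simp
    then have "v - (t + e) *\<^sub>R d \<le> 0"
      unfolding a_def using le_pprt by metis
    then show "v \<le> t *\<^sub>R d + e *\<^sub>R d" by (simp add: scaleR_left_distrib)
  qed
  with t show ?thesis by (auto intro: order.antisym)
qed

text \<open>The coordinate along \<open>d\<close> is the greatest coefficient that fits below
  \<open>x\<close>. It is additive because a Riesz decomposition of a multiple of \<open>d\<close>
  has multiples of \<open>d\<close> as its parts.\<close>

lemma discrete_elem_coordinate:
  fixes d :: "'a::banach_lattice"
  assumes d: "discrete_elem d"
  shows "\<exists>\<phi> :: 'a \<Rightarrow>\<^sub>L real. \<forall>x\<ge>0. 0 \<le> \<phi> x \<and> \<phi> x *\<^sub>R d \<le> x \<and> (\<forall>t. t *\<^sub>R d \<le> x \<longrightarrow> t \<le> \<phi> x)"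
proof -
  have d0: "0 < d" using d by (simp add: discrete_elem_def)
  have "\<forall>x. \<exists>c. 0 \<le> x \<longrightarrow> 0 \<le> c \<and> c *\<^sub>R d \<le> x \<and> (\<forall>t. t *\<^sub>R d \<le> x \<longrightarrow> t \<le> c)"
    using greatest_multiple_exists[OF d0] by blast
  then obtain q where q': "\<forall>x. 0 \<le> x \<longrightarrow> 0 \<le> q x \<and> q x *\<^sub>R d \<le> x \<and> (\<forall>t. t *\<^sub>R d \<le> x \<longrightarrow> t \<le> q x)"
    unfolding choice_iff by blast
  then have q: "0 \<le> q x" "q x *\<^sub>R d \<le> x" "t *\<^sub>R d \<le> x \<Longrightarrow> t \<le> q x" if "0 \<le> x" for x t
    using that by blast+
  have multiple: "\<exists>t. p = t *\<^sub>R d" if p: "0 \<le> p" "p \<le> r *\<^sub>R d" and r: "0 < r" for p r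
  proof -
    have "inverse r *\<^sub>R p \<le> inverse r *\<^sub>R (r *\<^sub>R d)" using p r by (intro scaleR_left_mono) auto
    then have "inverse r *\<^sub>R p \<le> d" using r by simp
    moreover have "0 \<le> inverse r *\<^sub>R p" using p r by (intro scaleR_nonneg_nonneg) auto
    ultimately obtain t where "inverse r *\<^sub>R p = t *\<^sub>R d"
      using discrete_elem_interval[OF d] by blast
    then have "r *\<^sub>R (inverse r *\<^sub>R p) = (r * t) *\<^sub>R d" by simp
    then have "p = (r * t) *\<^sub>R d" using r by simp
    then show ?thesis by blast
  qed
  have "q (x + y) = q x + q y" if xy: "0 \<le> x" "0 \<le> y" for x y
  proof (rule antisym)
    have xy': "0 \<le> x + y" using xy by simp
    show "q (x + y) \<le> q x + q y"
    proof (cases "q (x + y) = 0")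
      case True
      then show ?thesis using q(1)[OF xy(1)] q(1)[OF xy(2)] by simp
    next
      case False
      let ?r = "q (x + y)"
      have r: "0 < ?r" using False q(1)[OF xy'] by simp
      have rd: "0 \<le> ?r *\<^sub>R d" using r d0 by (intro scaleR_nonneg_nonneg) auto
      obtain a b where ab: "?r *\<^sub>R d = a + b" "0 \<le> a" "a \<le> x" "0 \<le> b" "b \<le> y"
        using riesz_decomposition[OF xy rd q(2)[OF xy']] by metis
      obtain s t where st: "a = s *\<^sub>R d" "b = t *\<^sub>R d"
        using multiple[of a ?r] multiple[of b ?r] ab r by auto
      have "?r = s + t"
        using ab(1) less_imp_neq[OF d0] unfolding st by (simp flip: scaleR_left_distrib)
      moreover have "s \<le> q x" "t \<le> q y"
        using q(3)[OF xy(1)] q(3)[OF xy(2)] ab st by auto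
      ultimately show ?thesis by simp
    qed
    show "q x + q y \<le> q (x + y)"
      using add_mono[OF q(2)[OF xy(1)] q(2)[OF xy(2)]]
      by (intro q(3)[OF xy']) (simp add: scaleR_left_distrib)
  qed
  then obtain \<phi> :: "'a \<Rightarrow>\<^sub>L real" where "\<And>x. 0 \<le> x \<Longrightarrow> \<phi> x = q x"
    using additive_extend[of q] q(1) by blast
  with q' show ?thesis by (intro exI[of _ \<phi>]) simp
qed

text \<open>The coordinate functional acts like a lattice homomorphism: if a positive multiple of
  \<open>d\<close> lies below the positive part of \<open>z n\<close>, no positive multiple lies
  below the negative part. The coordinate of \<open>z n\<close>, which tends to 0, therefore bounds
  the infimum.\<close>

lemma inf_discrete_elem_null:
  fixes d :: "'a::banach_lattice"
  assumes d: "discrete_elem d" and z: "weakly_null z"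
  shows "(\<lambda>n. norm (inf (pprt (z n)) d)) \<longlonglongrightarrow> 0"
proof -
  have d0: "0 < d" using d by (simp add: discrete_elem_def)
  obtain \<phi> :: "'a \<Rightarrow>\<^sub>L real" where \<phi>': "\<forall>x\<ge>0. 0 \<le> \<phi> x \<and> \<phi> x *\<^sub>R d \<le> x \<and> (\<forall>t. t *\<^sub>R d \<le> x \<longrightarrow> t \<le> \<phi> x)"
    using discrete_elem_coordinate[OF d] by blast
  then have \<phi>: "0 \<le> \<phi> x" "\<phi> x *\<^sub>R d \<le> x" "t *\<^sub>R d \<le> x \<Longrightarrow> t \<le> \<phi> x" if "0 \<le> x" for x t
    using that by blast+
  have "norm (inf (pprt (z n)) d) \<le> \<bar>\<phi> (z n)\<bar> * norm d" for n
  proof -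
    have "0 \<le> inf (pprt (z n)) d" using d0 by simp
    then obtain t where t: "0 \<le> t" "inf (pprt (z n)) d = t *\<^sub>R d"
      using discrete_elem_interval[OF d] by (metis inf_le2)
    have "t \<le> \<bar>\<phi> (z n)\<bar>"
    proof (cases "t = 0")
      case False
      let ?s = "\<phi> (pprt (- z n))"
      have td: "t *\<^sub>R d \<le> pprt (z n)" unfolding t(2)[symmetric] by simp
      have s: "0 \<le> ?s" "?s *\<^sub>R d \<le> pprt (- z n)" using \<phi> zero_le_pprt by blast+
      have "min ?s t *\<^sub>R d \<le> t *\<^sub>R d" "min ?s t *\<^sub>R d \<le> ?s *\<^sub>R d"
        using d0 by (auto intro!: scaleR_right_mono)
      then have "min ?s t *\<^sub>R d \<le> inf (pprt (z n)) (pprt (- z n))"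
        using td s(2) order_trans by (metis le_infI)
      then have "min ?s t \<le> 0"
        using scaleR_le_zero_imp[OF d0] by (simp only: inf_pprt_pprt_uminus)
      then have "?s = 0" using False t(1) s(1) by auto
      moreover have "\<phi> (z n) = \<phi> (pprt (z n)) - ?s"
        by (simp only: pprt_diff_pprt_uminus flip: blinfun.diff_right)
      moreover have "t \<le> \<phi> (pprt (z n))" using \<phi>(3)[OF zero_le_pprt td] .
      ultimately show ?thesis by simp
    qed simp
    then show ?thesis using t by (simp add: mult_right_mono)
  qed
  then have "\<forall>\<^sub>F n in sequentially. norm (norm (inf (pprt (z n)) d)) \<le> \<bar>\<phi> (z n)\<bar> * norm d"
    by simp
  moreover have "(\<lambda>n. \<bar>\<phi> (z n)\<bar> * norm d) \<longlonglongrightarrow> 0"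
    by (rule tendsto_mult_left_zero[OF tendsto_rabs_zero[OF
            weakly_null_tendsto[OF z blinfun.bounded_linear_right]]])
  ultimately show ?thesis
    by (rule Lim_null_comparison)
qed

text \<open>The set V of those v in the interval from 0 to u that satisfy the claim is upward directed and
  absorbs every discrete element fitting below u; hence \<open>u - V\<close> decreases to 0.\<close>

lemma inf_interval_null:
  fixes z :: "nat \<Rightarrow> 'a::banach_lattice"
  assumes disc: "discrete_lattice TYPE('a)" and ocn: "order_continuous_norm TYPE('a)"
    and z: "weakly_null z" and u: "0 \<le> u"
  shows "(\<lambda>n. norm (inf (pprt (z n)) u)) \<longlonglongrightarrow> 0"
proof -
  let ?N = "\<lambda>v n. norm (inf (pprt (z n)) v)"
  define V where "V = {v. 0 \<le> v \<and> v \<le> u \<and> ?N v \<longlonglongrightarrow> 0}"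
  have N_mono: "?N v n \<le> ?N w n" if "0 \<le> v" "v \<le> w" for v w n
    using that by (intro norm_mono_nonneg inf_mono) auto
  have N_add: "?N (v + w) n \<le> ?N v n + ?N w n" if "0 \<le> v" "0 \<le> w" for v w n
  proof -
    have "?N (v + w) n \<le> norm (inf (pprt (z n)) v + inf (pprt (z n)) w)"
      using that by (intro norm_mono_nonneg inf_add_le) auto
    then show ?thesis using norm_triangle_ineq order_trans by blast
  qed
  have V_add: "?N w \<longlonglongrightarrow> 0" if "0 \<le> v" "0 \<le> v'" "0 \<le> w" "w \<le> v + v'" "?N v \<longlonglongrightarrow> 0" "?N v' \<longlonglongrightarrow> 0" for v v' w
  proof (rule Lim_null_comparison)
    show "(\<lambda>n. ?N v n + ?N v' n) \<longlonglongrightarrow> 0" using tendsto_add[OF that(5,6)] by simp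
    have "?N w n \<le> ?N v n + ?N v' n" for n
      using order_trans[OF N_mono[OF that(3,4)] N_add[OF that(1,2)]] .
    then show "\<forall>\<^sub>F n in sequentially. norm (?N w n) \<le> ?N v n + ?N v' n"
      by simp
  qed
  define D where "D = (\<lambda>v. u - v) ` V"
  have "0 \<in> V" using u by (simp add: V_def inf_absorb2)
  then have "D \<noteq> {}" by (auto simp: D_def)
  moreover have "\<forall>a\<in>D. \<forall>b\<in>D. \<exists>c\<in>D. c \<le> a \<and> c \<le> b"
  proof (intro ballI)
    fix a b assume "a \<in> D" "b \<in> D"
    then obtain v w where vw: "v \<in> V" "w \<in> V" "a = u - v" "b = u - w" by (auto simp: D_def)
    have 1: "0 \<le> v" "0 \<le> w" and 2: "?N v \<longlonglongrightarrow> 0" "?N w \<longlonglongrightarrow> 0"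
      using vw by (simp_all add: V_def)
    have "0 \<le> sup v w" "sup v w \<le> v + w" using 1 by (auto intro: le_supI1)
    from V_add[OF 1 this 2] have "?N (sup v w) \<longlonglongrightarrow> 0" .
    then have "sup v w \<in> V" using vw \<open>0 \<le> sup v w\<close> by (simp add: V_def)
    then have "u - sup v w \<in> D" unfolding D_def by (rule imageI)
    moreover have "u - sup v w \<le> a" "u - sup v w \<le> b"
      unfolding vw by (rule diff_left_mono, simp)+
    ultimately show "\<exists>c\<in>D. c \<le> a \<and> c \<le> b" by blast
  qed
  moreover have "\<forall>a\<in>D. 0 \<le> a" by (auto simp: D_def V_def)
  moreover have "y \<le> 0" if y: "\<forall>a\<in>D. y \<le> a" for y
  proof (rule ccontr)
    assume "\<not> y \<le> 0"
    then have "pprt y \<noteq> 0" using le_zero_iff_zero_pprt by blast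
    then have "0 < pprt y" by (simp add: order.strict_iff_order)
    then obtain d where d: "0 \<le> d" "d \<le> pprt y" "discrete_elem d"
      using disc[unfolded discrete_lattice_def, rule_format, of "pprt y"] by auto
    have below: "v + d \<le> u" if "v \<in> V" for v
    proof -
      have "u - v \<in> D" using that by (simp add: D_def)
      with y have "y \<le> u - v" by blast
      moreover have "0 \<le> u - v" using that by (simp add: V_def)
      ultimately have "pprt y \<le> u - v" by (simp add: pprt_def)
      with d(2) have "d \<le> u - v" by (rule order_trans)
      then show ?thesis by (simp add: le_diff_eq add.commute)
    qed
    have step: "v + d \<in> V" if "v \<in> V" for v
    proof -
      have v: "0 \<le> v" "?N v \<longlonglongrightarrow> 0" using that by (simp_all add: V_def)
      have "?N (v + d) \<longlonglongrightarrow> 0"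
        by (rule V_add[OF v(1) d(1) add_nonneg_nonneg[OF v(1) d(1)] order_refl v(2)
              inf_discrete_elem_null[OF d(3) z]])
      then show ?thesis using below[OF that] that d by (auto simp: V_def)
    qed
    \<comment> \<open>If 0 were not the infimum of \<open>D\<close>, repeated absorption of
      \<open>d\<close> would keep all its multiples below \<open>u\<close>, against the archimedean
      property.\<close>
    have mult: "real k *\<^sub>R d \<in> V" for k
    proof (induction k)
      case (Suc k)
      from step[OF this] show ?case by (simp add: scaleR_left_distrib add.commute)
    qed (use \<open>0 \<in> V\<close> in simp)
    have d0: "0 < d" using d(3) by (simp add: discrete_elem_def)
    obtain c where c: "\<And>t. t *\<^sub>R d \<le> u \<Longrightarrow> t \<le> c"
      using greatest_multiple_exists[OF d0 u] by blast
    have "real k \<le> c" for k using mult[of k] by (intro c) (simp add: V_def)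
    moreover obtain k where "c < real k" using reals_Archimedean2 by blast
    ultimately show False by (meson not_less)
  qed
  ultimately have small: "\<exists>a\<in>D. norm a < e" if "0 < e" for e
    using ocn[unfolded order_continuous_norm_def, rule_format, of D] that by blast
  \<comment> \<open>Order continuity supplies \<open>v\<close> in \<open>V\<close> close to
    \<open>u\<close> in norm; subadditivity then splits the infimum with \<open>u\<close> into one
    with \<open>v\<close>, which tends to 0, and a remainder of norm at most that of
    \<open>u - v\<close>.\<close>
  show ?thesis
  proof (rule LIMSEQ_I)
    fix e :: real assume e: "0 < e"
    then obtain a where "a \<in> D" "norm a < e/2" using small[of "e/2"] by auto
    then obtain v where v: "v \<in> V" "norm (u - v) < e/2" by (auto simp: D_def)
    then have v0: "0 \<le> v" "0 \<le> u - v" by (auto simp: V_def)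
    have "?N v \<longlonglongrightarrow> 0" using v by (simp add: V_def)
    then have "\<forall>\<^sub>F n in sequentially. ?N v n < e/2"
      using e by (intro order_tendstoD(2)[of _ 0]) auto
    then obtain M where M: "\<And>n. n \<ge> M \<Longrightarrow> ?N v n < e/2"
      by (auto simp: eventually_sequentially)
    have "norm (?N u n - 0) < e" if "n \<ge> M" for n
    proof -
      have "?N (v + (u - v)) n \<le> ?N v n + ?N (u - v) n" using v0 by (rule N_add)
      moreover have "?N (u - v) n \<le> norm (u - v)"
        using v0 by (intro norm_mono_nonneg) auto
      ultimately show ?thesis using M[OF that] v(2) by simp
    qed
    then show "\<exists>M. \<forall>n\<ge>M. norm (?N u n - 0) < e" by blast
  qed
qed

lemma weakly_null_pprt_imp_labs:
  fixes z :: "nat \<Rightarrow> 'a::banach_lattice"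
  assumes "weakly_null (\<lambda>n. pprt (z n))" "weakly_null (\<lambda>n. pprt (- z n))"
  shows "weakly_null (\<lambda>n. labs (z n))"
  unfolding weakly_null_def
proof
  fix \<phi> :: "'a \<Rightarrow>\<^sub>L real"
  have "(\<lambda>n. \<phi> (pprt (z n)) + \<phi> (pprt (- z n))) \<longlonglongrightarrow> 0 + 0"
    by (intro tendsto_add assms[THEN weakly_null_tendsto] blinfun.bounded_linear_right)
  then show "(\<lambda>n. \<phi> (labs (z n))) \<longlonglongrightarrow> 0"
    by (simp flip: pprt_add_pprt_uminus add: blinfun.add_right)
qed

text \<open>The positive part of \<open>z n\<close> is split along a subsequence into disjoint
  terms, weakly null as they lie below a weakly null sequence, and a remainder confined by
  \<open>h n\<close> and a vanishing multiple of \<open>w\<close>.\<close>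

lemma discrete_imp_swclo:
  assumes disc: "discrete_lattice TYPE('a::banach_lattice)" and ocn: "order_continuous_norm TYPE('a)"
  shows "swclo TYPE('a)"
  unfolding swclo_def
proof (intro allI impI)
  have pp: "weakly_null (\<lambda>n. pprt (z n))" if z: "weakly_null z" for z :: "nat \<Rightarrow> 'a"
  proof (rule weakly_null_positiveI, rule tendsto_zero_subseqI)
    fix \<phi> :: "'a \<Rightarrow>\<^sub>L real" and t :: "nat \<Rightarrow> nat"
    assume pos: "\<And>x. 0 \<le> x \<Longrightarrow> 0 \<le> \<phi> x" and t: "strict_mono t"
    have mono: "\<phi> u \<le> \<phi> v" if "u \<le> v" for u v
      using pos that by (rule blinfun_pos_mono)
    define g where "g n = z (t n)" for n
    have g: "weakly_null g" unfolding g_def by (rule weakly_null_subseq[OF t z])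
    \<comment> \<open>The error to be controlled is the value of \<open>\<phi>\<close> on the part
      of the sequence below \<open>h\<close>; discreteness and order continuity make that part tend
      to 0 in norm.\<close>
    define C where "C h n = \<phi> (inf (pprt (g n)) h)" for h n
    have C: "C h \<longlonglongrightarrow> 0" if "0 \<le> h" for h
    proof -
      have "(\<lambda>n. inf (pprt (g n)) h) \<longlonglongrightarrow> 0"
        using inf_interval_null[OF disc ocn g that] by (rule tendsto_norm_zero_cancel)
      then have "(\<lambda>n. \<phi> (inf (pprt (g n)) h)) \<longlonglongrightarrow> \<phi> 0"
        by (intro tendsto_intros)
      then show ?thesis unfolding C_def by simp
    qed
    obtain s u h w where s: "strict_mono s" and u: "weakly_null u" "\<And>n. 0 \<le> u n"
      and h: "\<And>n. 0 \<le> h n" and w: "0 \<le> w"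
      and rest: "\<And>n. pprt (g (s n)) - u n = inf (pprt (g (s n))) (h n + ((1/2)^n) *\<^sub>R w)"
      and Ch: "\<And>n. C (h n) (s n) < (1/2)^n"
      using disjointification[of g C, OF g C] by blast
    have "\<phi> (pprt (g (s n))) \<le> \<phi> (u n) + (1/2)^n + (1/2)^n * \<phi> w" for n
    proof -
      have w': "0 \<le> ((1/2)^n) *\<^sub>R w" using w by (intro scaleR_nonneg_nonneg) auto
      have "pprt (g (s n)) - u n \<le> inf (pprt (g (s n))) (h n) + inf (pprt (g (s n))) (((1/2)^n) *\<^sub>R w)"
        unfolding rest using h w' by (intro inf_add_le) auto
      also have "\<dots> \<le> inf (pprt (g (s n))) (h n) + ((1/2)^n) *\<^sub>R w"
        by (rule add_left_mono) simp
      finally have "\<phi> (pprt (g (s n)) - u n) \<le> C (h n) (s n) + (1/2)^n * \<phi> w"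
        unfolding C_def by (auto dest: mono simp: blinfun.bilinear_simps)
      with Ch[of n] show ?thesis by (simp add: blinfun.diff_right)
    qed
    then have "\<forall>\<^sub>F n in sequentially. norm (\<phi> (pprt (g (s n)))) \<le> \<phi> (u n) + (1/2)^n + (1/2)^n * \<phi> w"
      using pos[OF zero_le_pprt] by simp
    moreover have half: "(\<lambda>n. (1/2::real)^n) \<longlonglongrightarrow> 0"
      by (rule LIMSEQ_power_zero) simp
    have "(\<lambda>n. \<phi> (u n) + (1/2)^n + (1/2)^n * \<phi> w) \<longlonglongrightarrow> 0 + 0 + 0 * \<phi> w"
      by (rule tendsto_add[OF tendsto_add[OF weakly_null_tendsto[OF u(1) blinfun.bounded_linear_right]
              half] tendsto_mult[OF half tendsto_const]])
    then have "(\<lambda>n. \<phi> (u n) + (1/2)^n + (1/2)^n * \<phi> w) \<longlonglongrightarrow> 0"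
      by simp
    ultimately have "(\<lambda>n. \<phi> (pprt (g (s n)))) \<longlonglongrightarrow> 0"
      by (rule Lim_null_comparison)
    then show "\<exists>s. strict_mono s \<and> (\<lambda>n. \<phi> (pprt (z (t (s n))))) \<longlonglongrightarrow> 0"
      using s unfolding g_def by blast
  qed
  fix z :: "nat \<Rightarrow> 'a" assume z: "weakly_null z"
  show "weakly_null (\<lambda>n. labs (z n))"
    by (rule weakly_null_pprt_imp_labs[OF pp[OF z] pp[OF weakly_null_minus[OF z]]])
qed


section \<open>Order bounded operators\<close>

lemma labs_triangle: "labs (x + y) \<le> labs x + labs (y::'a::banach_lattice)"
  unfolding labs_def[of "x + y"]
proof (rule le_supI)
  show "x + y \<le> labs x + labs y" by (intro add_mono labs_ge)
  have "- x + - y \<le> labs x + labs y" by (intro add_mono labs_ge)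
  then show "- (x + y) \<le> labs x + labs y" by simp
qed

lemma dual_interval_apply_le:
  fixes r h :: "'b::banach_lattice dual"
  assumes "0 \<le> r" "r \<le> h" "- z \<le> y" "y \<le> z"
  shows "\<bar>of_dual r y\<bar> \<le> of_dual h z"
proof -
  have pos: "0 \<le> of_dual r v" if "0 \<le> v" for v
    using assms(1) that by (simp add: less_eq_dual_def dual_le_def)
  have "of_dual r y \<le> of_dual r z" "of_dual r (- y) \<le> of_dual r z"
    using blinfun_pos_mono[of "of_dual r"] pos assms(3,4) by (auto simp: minus_le_iff)
  moreover have "of_dual r z \<le> of_dual h z"
  proof -
    have "0 \<le> z + z" using add_mono[OF order_trans[OF assms(3,4)] order_refl[of z]] by simp
    then show ?thesis using assms(2) by (simp add: less_eq_dual_def dual_le_def)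
  qed
  ultimately show ?thesis by (simp add: blinfun.minus_right abs_le_iff)
qed

lemma order_bounded_op_interval:
  fixes T :: "'a::banach_lattice \<Rightarrow> 'b::banach_lattice"
  assumes "order_bounded_op T"
  obtains z where "\<And>y. y \<in> {a..b} \<Longrightarrow> - z \<le> T y \<and> T y \<le> z"
proof -
  obtain c d where cd: "T ` {a..b} \<subseteq> {c..d}"
    using assms unfolding order_bounded_op_def by blast
  show thesis
  proof
    fix y assume "y \<in> {a..b}"
    then have "T y \<in> {c..d}" using cd by blast
    then have y: "c \<le> T y" "T y \<le> d" by simp_all
    have "- (labs c + labs d) \<le> - labs c" "- labs c \<le> c"
      using labs_nonneg[of d] labs_ge(2)[of c] by (simp_all add: minus_le_iff)
    moreover have "d \<le> labs c + labs d"
      using labs_nonneg[of c] labs_ge(1)[of d] add_mono[of 0 "labs c" d "labs d"] by simp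
    ultimately show "- (labs c + labs d) \<le> T y \<and> T y \<le> labs c + labs d"
      using y order_trans by blast
  qed
qed

text \<open>Order boundedness confines the image of the interval between \<open>- z\<close> and
  \<open>z\<close>, so a positive functional is controlled on it by its value at the single point
  \<open>z\<close>, where weak nullity applies.\<close>

lemma null_on_intervals_dual:
  fixes T :: "'a::banach_lattice \<Rightarrow> 'b::banach_lattice" and u :: "nat \<Rightarrow> 'b dual"
  assumes T: "order_bounded_op T" and u: "weakly_null u" "\<And>n. 0 \<le> u n"
  shows "null_on_intervals (\<lambda>n r. of_dual (u n) (T r))"
  unfolding null_on_intervals_def
proof (intro allI impI)
  fix h :: 'a assume "0 \<le> h"
  obtain z where z: "\<And>y. y \<in> {0..h} \<Longrightarrow> - z \<le> T y \<and> T y \<le> z"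
    using order_bounded_op_interval[OF T] by metis
  have "bounded_linear (\<lambda>f. of_dual f z)"
    by (rule bounded_linear_compose[OF blinfun.bounded_linear_left bounded_linear_of_dual])
  then have "(\<lambda>n. of_dual (u n) z) \<longlonglongrightarrow> 0"
    by (rule weakly_null_tendsto[OF u(1)])
  moreover have "\<bar>of_dual (u n) (T r)\<bar> \<le> of_dual (u n) z" if "0 \<le> r" "r \<le> h" for n r
    using z[of r] that by (intro dual_interval_apply_le u) auto
  ultimately show "\<exists>c. c \<longlonglongrightarrow> 0 \<and> (\<forall>n r. 0 \<le> r \<longrightarrow> r \<le> h \<longrightarrow> \<bar>of_dual (u n) (T r)\<bar> \<le> c n)"
    by blast
qed

lemma null_on_intervals_labs:
  fixes T :: "'a \<Rightarrow> 'b::banach_lattice"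
  assumes "\<And>h :: 'b dual. 0 \<le> h \<Longrightarrow> (\<lambda>n. of_dual h (labs (T (x n)))) \<longlonglongrightarrow> 0"
  shows "null_on_intervals (\<lambda>n r. of_dual r (T (x n)))"
  unfolding null_on_intervals_def
proof (intro allI impI)
  fix h :: "'b dual" assume h: "0 \<le> h"
  have "\<bar>of_dual r (T (x n))\<bar> \<le> of_dual h (labs (T (x n)))" if "0 \<le> r" "r \<le> h" for r n
    using that labs_ge[of "T (x n)"] by (intro dual_interval_apply_le) (auto simp: minus_le_iff)
  then show "\<exists>c. c \<longlonglongrightarrow> 0 \<and> (\<forall>n r. 0 \<le> r \<longrightarrow> r \<le> h \<longrightarrow> \<bar>of_dual r (T (x n))\<bar> \<le> c n)"
    using assms[OF h] by blast
qed

text \<open>The adjoint of an order bounded operator is regular although the operator itself need not be: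
  finite sums of \<open>\<bar>T x\<^sub>i\<bar>\<close> over partitions of \<open>x\<close> stay in one order interval.\<close>

lemma order_bounded_op_dominated:
  fixes T :: "'a::banach_lattice \<Rightarrow> 'b::banach_lattice" and h :: "'b dual"
  assumes lin: "linear T" and T: "order_bounded_op T" and h: "0 \<le> h"
  shows "\<exists>\<tau> :: 'a \<Rightarrow>\<^sub>L real. \<forall>x\<ge>0. of_dual h (labs (T x)) \<le> \<tau> x"
proof -
  define p where "p x = of_dual h (labs (T x))" for x
  have pos: "0 \<le> of_dual h v" if "0 \<le> v" for v
    using h that by (simp add: less_eq_dual_def dual_le_def)
  have mono: "of_dual h u \<le> of_dual h v" if "u \<le> v" for u v
    using pos that by (rule blinfun_pos_mono)
  have "\<exists>\<tau> :: 'a \<Rightarrow>\<^sub>L real. \<forall>x. 0 \<le> x \<longrightarrow> p x \<le> \<tau> x \<and>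
    (\<forall>M. (\<forall>xs. list_all ((\<le>) 0) xs \<longrightarrow> sum_list xs = x \<longrightarrow> sum_list (map p xs) \<le> M) \<longrightarrow> \<tau> x \<le> M)"
  proof (rule least_additive_majorant)
    fix x y :: 'a
    show "p (x + y) \<le> p x + p y"
      using mono[OF labs_triangle[of "T x" "T y"]]
      by (simp add: p_def linear_add[OF lin] blinfun.add_right)
    show "p 0 = 0" by (simp add: p_def linear_0[OF lin] labs_def)
    show "0 \<le> p x" unfolding p_def by (rule pos[OF labs_nonneg])
    obtain z where z: "\<And>y. y \<in> {-x..x} \<Longrightarrow> - z \<le> T y \<and> T y \<le> z"
      using order_bounded_op_interval[OF T] by metis
    have "sum_list (map p xs) \<le> of_dual h z" if xs: "list_all ((\<le>) 0) xs" "sum_list xs = x" for xs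
    proof -
      have "0 + sum_list (map (\<lambda>v. labs (T v)) xs) \<le> z"
      proof (rule sum_list_labs_le[OF linear_add[OF lin] linear_neg[OF lin] xs(1)])
        fix y assume "- sum_list xs \<le> y" "y \<le> sum_list xs"
        with z[of y] xs(2) show "0 + T y \<le> z" by simp
      qed
      then have "of_dual h (sum_list (map (\<lambda>v. labs (T v)) xs)) \<le> of_dual h z"
        by (intro mono) simp
      moreover have "of_dual h (sum_list (map (\<lambda>v. labs (T v)) xs)) = sum_list (map p xs)"
        by (induction xs) (simp_all add: p_def blinfun.add_right)
      ultimately show ?thesis by simp
    qed
    then show "\<exists>M. \<forall>xs. list_all ((\<le>) 0) xs \<and> sum_list xs = x \<longrightarrow> sum_list (map p xs) \<le> M"
      by blast
  qed
  then show ?thesis unfolding p_def by blast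
qed

text \<open>The map \<open>h (labs (T x))\<close> is not linear in \<open>x\<close>, so weak nullity
  cannot be applied to it directly; on positive elements it is dominated by a bounded functional
  \<open>\<tau>\<close>.\<close>

lemma null_on_intervals_positive:
  fixes T :: "'a::banach_lattice \<Rightarrow> 'b::banach_lattice"
  assumes lin: "linear T" and T: "order_bounded_op T"
    and x: "weakly_null x" "\<And>n. 0 \<le> x n"
  shows "null_on_intervals (\<lambda>n r. of_dual r (T (x n)))"
proof (rule null_on_intervals_labs)
  fix h :: "'b dual" assume h: "0 \<le> h"
  obtain \<tau> :: "'a \<Rightarrow>\<^sub>L real" where \<tau>: "\<forall>x\<ge>0. of_dual h (labs (T x)) \<le> \<tau> x"
    using order_bounded_op_dominated[OF lin T h] by blast
  have "0 \<le> of_dual h (labs (T (x n)))" for n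
    using h labs_nonneg[of "T (x n)"] by (simp add: less_eq_dual_def dual_le_def)
  with \<tau> x(2) have "\<forall>\<^sub>F n in sequentially. norm (of_dual h (labs (T (x n)))) \<le> \<tau> (x n)" by simp
  then show "(\<lambda>n. of_dual h (labs (T (x n)))) \<longlonglongrightarrow> 0"
    by (rule Lim_null_comparison) (rule weakly_null_tendsto[OF x(1) blinfun.bounded_linear_right])
qed

lemma swclo_imp_weakly_null_pprt:
  fixes x :: "nat \<Rightarrow> 'a::banach_lattice"
  assumes "swclo TYPE('a)" "weakly_null x"
  shows "weakly_null (\<lambda>n. pprt (x n))"
  unfolding weakly_null_def
proof
  fix \<phi> :: "'a \<Rightarrow>\<^sub>L real"
  have "pprt z = (1/2) *\<^sub>R (labs z + z)" for z :: 'a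
  proof -
    have "labs z + z = (pprt z + pprt (- z)) + (pprt z - pprt (- z))"
      by (simp only: pprt_add_pprt_uminus pprt_diff_pprt_uminus)
    then show ?thesis by (simp flip: scaleR_2)
  qed
  then have eq: "\<phi> (pprt (x n)) = 1/2 * (\<phi> (labs (x n)) + \<phi> (x n))" for n
    by (simp only: blinfun.scaleR_right blinfun.add_right real_scaleR_def)
  have "weakly_null (\<lambda>n. labs (x n))" using assms unfolding swclo_def by blast
  from tendsto_mult[OF tendsto_const[of "1/2"] tendsto_add[OF
        weakly_null_tendsto[OF this blinfun.bounded_linear_right]
        weakly_null_tendsto[OF assms(2) blinfun.bounded_linear_right]]]
  show "(\<lambda>n. \<phi> (pprt (x n))) \<longlonglongrightarrow> 0" unfolding eq by simp
qed

section \<open>The equivalence under each of the three alternatives\<close>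

theorem theoremA:
  fixes T :: "'a::banach_lattice \<Rightarrow> 'b::banach_lattice"
  assumes "bounded_linear T"
    and "order_bounded_op T"
    and "swclo TYPE('a) \<or> dual_swclo TYPE('b) \<or>
         (positive_op T \<and> discrete_lattice TYPE('b) \<and> order_continuous_norm TYPE('b))"
  shows "awDP T \<longleftrightarrow> wDP T"
proof
  show "awDP T" if "wDP T" using that unfolding awDP_def wDP_def by blast
next
  assume aw: "awDP T"
  define B where "B x f = of_dual f (T x)" for x :: 'a and f :: "'b dual"
  have linT: "linear T" using assms(1) by (rule bounded_linear.linear)
  have lin1: "linear (\<lambda>x. B x f)" for f
    by (rule linearI) (simp_all add: B_def linear_add[OF linT] linear_cmul[OF linT] blinfun.bilinear_simps)
  have lin2: "linear (B x)" for x
    by (rule linearI) (simp_all add: B_def blinfun.bilinear_simps)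
  have disj: "(\<lambda>n. B (x n) (f n)) \<longlonglongrightarrow> 0"
    if "disjoint_seq x" "weakly_null x" "disjoint_seq f" "weakly_null f" for x f
  proof -
    have "dual_disjoint_seq (\<lambda>n. of_dual (f n))"
      using that(3) unfolding disjoint_seq_def dual_disjoint_seq_def by (simp add: dual_disjointI)
    then show ?thesis
      using aw[unfolded awDP_def, rule_format, of x "\<lambda>n. of_dual (f n)"] that weakly_null_of_dual[OF that(4)]
      by (simp add: B_def)
  qed
  have pos1: "null_on_intervals (\<lambda>n. B (x n))" if "weakly_null x" "\<And>n. 0 \<le> x n" for x
    unfolding B_def by (rule null_on_intervals_positive[OF linT assms(2) that])
  have pos2: "null_on_intervals (\<lambda>n r. B r (u n))" if "weakly_null u" "\<And>n. 0 \<le> u n" for u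
    unfolding B_def by (rule null_on_intervals_dual[OF assms(2) that])
  \<comment> \<open>Here the functionals are made disjoint first, at the price of smallness of
    \<open>B (x n)\<close> on intervals of the dual.\<close>
  have left: "(\<lambda>n. B (x n) (f n)) \<longlonglongrightarrow> 0"
    if "weakly_null x" "null_on_intervals (\<lambda>n. B (x n))" "weakly_null f" for x f
    by (rule bilinear_null_from_disjoint[of B]) (fact lin1 lin2 disj pos2 that)+
  \<comment> \<open>The same argument for the transposed form: the points are made disjoint
    first.\<close>
  have right: "(\<lambda>n. B (x n) (f n)) \<longlonglongrightarrow> 0"
    if "weakly_null f" "null_on_intervals (\<lambda>n r. B r (f n))" "weakly_null x" for x f
  proof (rule bilinear_null_from_disjoint[of "\<lambda>f x. B x f"])
    show "(\<lambda>n. B (y n) (g n)) \<longlonglongrightarrow> 0"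
      if "disjoint_seq g" "weakly_null g" "disjoint_seq y" "weakly_null y" for g y
      by (rule disj[OF that(3,4,1,2)])
  qed (fact lin1 lin2 pos1 that)+
  \<comment> \<open>The alternatives differ in the source of the first estimate: positive parts of
    the points, positive parts of the functionals, or weak nullity of \<open>labs (T (x n))\<close>
    in the target.\<close>
  have main: "(\<lambda>n. B (x n) (f n)) \<longlonglongrightarrow> 0" if x: "weakly_null x" and f: "weakly_null f" for x f
    using assms(3)
  proof (elim disjE conjE)
    assume E: "swclo TYPE('a)"
    have *: "(\<lambda>n. B (pprt (y n)) (f n)) \<longlonglongrightarrow> 0" if "weakly_null y" for y
      by (intro left pos1 f swclo_imp_weakly_null_pprt[OF E that] zero_le_pprt)
    have "B (pprt y) g - B (pprt (- y)) g = B y g" for y g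
      using linear_diff[OF lin1[of g], of "pprt y" "pprt (- y)"] by (simp only: pprt_diff_pprt_uminus)
    then show ?thesis
      using tendsto_diff[OF *[OF x] *[OF weakly_null_minus[OF x]]] by simp
  next
    assume "dual_swclo TYPE('b)"
    then have F: "swclo TYPE('b dual)" by (rule dual_swclo_imp_swclo)
    have *: "(\<lambda>n. B (x n) (pprt (g n))) \<longlonglongrightarrow> 0" if "weakly_null g" for g
      by (intro right pos2 x swclo_imp_weakly_null_pprt[OF F that] zero_le_pprt)
    have "B y (pprt g) - B y (pprt (- g)) = B y g" for y g
      using linear_diff[OF lin2[of y], of "pprt g" "pprt (- g)"] by (simp only: pprt_diff_pprt_uminus)
    then show ?thesis
      using tendsto_diff[OF *[OF f] *[OF weakly_null_minus[OF f]]] by simp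
  next
    assume "discrete_lattice TYPE('b)" "order_continuous_norm TYPE('b)"
    then have "swclo TYPE('b)" by (rule discrete_imp_swclo)
    then have "weakly_null (\<lambda>n. labs (T (x n)))"
      using weakly_null_bounded_linear[OF assms(1) x] unfolding swclo_def by blast
    then have "(\<lambda>n. of_dual h (labs (T (x n)))) \<longlonglongrightarrow> 0" for h
      by (rule weakly_null_tendsto) (rule blinfun.bounded_linear_right)
    then have "null_on_intervals (\<lambda>n. B (x n))"
      unfolding B_def by (rule null_on_intervals_labs)
    then show ?thesis by (intro left x f)
  qed
  show "wDP T"
    unfolding wDP_def
  proof (intro allI impI, elim conjE)
    fix x :: "nat \<Rightarrow> 'a" and f :: "nat \<Rightarrow> ('b \<Rightarrow>\<^sub>L real)"
    assume "weakly_null x" "weakly_null f"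
    from main[OF this(1) weakly_null_to_dual[OF this(2)]]
    show "(\<lambda>n. f n (T (x n))) \<longlonglongrightarrow> 0" by (simp add: B_def)
  qed
qed

end
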